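(* Let $(X,W)$ be an affine Landau-Ginzburg B-model ($X$ a smooth $n$-dimensional affine variety over $\mathbb{C}$ with a $\mathbb{C}^*$-action for which $-1$ acts trivially, and $W\in\mathcal{O}_X$ a function of weight $2$), and suppose that $W$ has isolated singularities. Let $(M,D)$ be a B-brane and let $\alpha\in\mathrm{End}(M)$ be a homogeneous endomorphism, regarded as a length-one chain in the Hochschild complex $C_\bullet(Br(X,W))$. Then the value of the functional $\mathrm{Res}_W\circ\phi\circ\mathrm{Tr}\circ T_d$ on $\alpha$ is $$\langle\alpha\rangle_{disc} = \frac{(-1)^{\lceil n/2\rceil}}{n!}\, \mathrm{Res}_{W}\left( \mathrm{Tr} \big( \alpha\, (dD)^ n \big)\right),$$ where $\mathrm{Tr}$ on the right-hand side is the supertrace.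
   Context: $\mathcal{O}_X$ denotes the algebra of global regular functions, graded by the $\mathbb{C}^*$-weights (so by even integers, with $W$ in degree 2). Shifts: $M[\sigma]^i=M^{i+\sigma}$. Isolated singularities means that the zero locus of $dW$ is finite. A B-brane is a pair $(M,D)$ with $M$ a finitely generated projective graded $\mathcal{O}_X$-module and $D$ a degree 1 $\mathcal{O}_X$-linear endomorphism with $D^2=W\,\mathrm{id}_M$; morphisms of B-branes $M\to N$ are elements of the graded space $\mathrm{Hom}_{\mathcal{O}_X}(M,N)$, and $\mathrm{End}(M)=\mathrm{Hom}_{\mathcal{O}_X}(M,M)$. Maps are written on the right. $C_\bullet(Br(X,W))$ has underlying space $\bigoplus_{k\ge0}\bigoplus_{M_0,\dots,M_k}\mathrm{Hom}(M_0,M_1)\otimes\cdots\otimes\mathrm{Hom}(M_k,M_0)[k]$; $\alpha\in\mathrm{End}(M)$ sits in the $k=0$ summand. The maps. On a single endomorphism, $T_d(\alpha)=\sum_{s\ge0}\alpha\otimes D^{\otimes s}$. Fix a realization of $M$ as a direct summand of a free module $\bigoplus_{i=1}^{r}\mathcal{O}_X[\sigma_i]$; endomorphisms of $M$ (extended by zero on the complement) become matrices with entries $\alpha_{ij}:\mathcal{O}_X[\sigma_i]\to\mathcal{O}_X[\sigma_j]$, acting on the right. The generalized trace is $$\mathrm{Tr}(\alpha^0\otimes\dots\otimes\alpha^t)=\sum_{i_0,\dots,i_t}(-1)^{\sigma}\alpha^0_{i_0i_1}\otimes\dots\otimes\alpha^{t-1}_{i_{t-1}i_t}\otimes\alpha^t_{i_ti_0}\in\mathcal{O}_X^{\otimes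 t+1},\quad \sigma=(|\alpha^0_{i_0i_1}|+\dots+|\alpha^t_{i_ti_0}|+t+1)\sigma_{i_0}+\sigma_{i_1}+\dots+\sigma_{i_t}.$$ $\phi:\mathcal{O}_X^{\otimes k+1}\to\Omega^k_X$ is $\phi(f_0\otimes\dots\otimes f_k)=\frac1{k!}f_0\,df_1\wedge\dots\wedge df_k$. On the right-hand side of the claim, $dD$ is the matrix of one-forms obtained by applying $d$ to each entry of $D$, products are matrix products over $\Omega^\bullet_X$, and the supertrace of a matrix $B$ of forms is $\sum_i(-1)^{\sigma_i}B_{ii}$. Residue map. $\mathrm{Res}_W:\Omega_X^\bullet\to\mathbb{C}$ is zero on $k$-forms with $k<n$, and on an $n$-form $\omega$ is the sum over the critical points $p$ of $W$ of $$\frac{1}{(2\pi i)^n}\oint_{|\partial_1W|=\dots=|\partial_nW|=\epsilon}\frac{\omega}{\prod_i\partial_iW},$$ computed in a local coordinate system $x_1,\dots,x_n$ at $p$ chosen once and for all ($\partial_i=\partial/\partial x_i$; for $X=\mathbb{C}^n$, the standard coordinates). *)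

theory Defs
  imports "HOL-Analysis.Analysis" "HOL-Algebra.Module" "HOL-Library.Poly_Mapping"
begin

section \<open>Affine varieties\<close>

type_synonym 'N pt = "complex ^ 'N"

inductive_set poly_fun :: "('N::finite pt \<Rightarrow> complex) set" where
  const: "(\<lambda>_. c) \<in> poly_fun"
| coord: "(\<lambda>x. x $ i) \<in> poly_fun"
| add: "P \<in> poly_fun \<Longrightarrow> Q \<in> poly_fun \<Longrightarrow> (\<lambda>x. P x + Q x) \<in> poly_fun"
| mult: "P \<in> poly_fun \<Longrightarrow> Q \<in> poly_fun \<Longrightarrow> (\<lambda>x. P x * Q x) \<in> poly_fun"

definition zariski_closed :: "'N::finite pt set \<Rightarrow> bool" where
  "zariski_closed Z \<longleftrightarrow> (\<exists>S\<subseteq>poly_fun. Z = {x. \<forall>P\<in>S. P x = 0})"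

definition irreducible_closed :: "'N::finite pt set \<Rightarrow> bool" where
  "irreducible_closed Z \<longleftrightarrow> zariski_closed Z \<and> Z \<noteq> {} \<and>
     (\<forall>A B. zariski_closed A \<longrightarrow> zariski_closed B \<longrightarrow> Z \<subseteq> A \<union> B \<longrightarrow> Z \<subseteq> A \<or> Z \<subseteq> B)"

definition irreducible_chain :: "'N::finite pt set \<Rightarrow> nat \<Rightarrow> (nat \<Rightarrow> 'N pt set) \<Rightarrow> bool" where
  "irreducible_chain Z k C \<longleftrightarrow>
     (\<forall>i\<le>k. irreducible_closed (C i) \<and> C i \<subseteq> Z) \<and> (\<forall>i<k. C i \<subset> C (Suc i))"

definition has_dimension :: "'N::finite pt set \<Rightarrow> nat \<Rightarrow> bool" where
  "has_dimension Z n \<longleftrightarrow>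
     (\<exists>C. irreducible_chain Z n C) \<and> (\<forall>k>n. \<not> (\<exists>C. irreducible_chain Z k C))"

definition irreducible_component :: "'N::finite pt set \<Rightarrow> 'N pt set \<Rightarrow> bool" where
  "irreducible_component X Z \<longleftrightarrow> irreducible_closed Z \<and> Z \<subseteq> X \<and>
     (\<forall>Z'. irreducible_closed Z' \<longrightarrow> Z \<subseteq> Z' \<longrightarrow> Z' \<subseteq> X \<longrightarrow> Z' = Z)"

definition dir_deriv :: "('N::finite pt \<Rightarrow> complex) \<Rightarrow> 'N pt \<Rightarrow> 'N pt \<Rightarrow> complex" where
  "dir_deriv f p v = deriv (\<lambda>t. f (p + t *s v)) 0"

definition tangent :: "'N::finite pt set \<Rightarrow> 'N pt \<Rightarrow> 'N pt set" where
  "tangent X p = {v. \<forall>P\<in>poly_fun. (\<forall>x\<in>X. P x = 0) \<longrightarrow> dir_deriv P p v = 0}"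

text \<open>Irreducibility is not imposed: a variety may have several irreducible (by smoothness:
  connected) components, all of dimension \<open>n\<close>. As the tangent spaces are cut out by the full
  vanishing ideal, the last conjunct is the Jacobian criterion.\<close>

definition smooth_affine_variety :: "nat \<Rightarrow> 'N::finite pt set \<Rightarrow> bool" where
  "smooth_affine_variety n X \<longleftrightarrow> zariski_closed X \<and> X \<noteq> {} \<and>
     (\<forall>Z. irreducible_component X Z \<longrightarrow> has_dimension Z n) \<and>
     (\<forall>p\<in>X. vec.dim (tangent X p) = n)"

text \<open>A regular function on \<open>X\<close> is represented by its extension by zero to the ambient space,
  so that equality of functions is equality on \<open>X\<close>.\<close>

definition regular :: "'N::finite pt set \<Rightarrow> ('N pt \<Rightarrow> complex) set" where
  "regular X = {(\<lambda>x. if x \<in> X then P x else 0) | P. P \<in> poly_fun}"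

definition const_fun :: "'N::finite pt set \<Rightarrow> complex \<Rightarrow> 'N pt \<Rightarrow> complex" where
  "const_fun X c = (\<lambda>x. if x \<in> X then c else 0)"

definition coord_ring :: "'N::finite pt set \<Rightarrow> ('N pt \<Rightarrow> complex) ring" where
  "coord_ring X = \<lparr>carrier = regular X, mult = (\<lambda>f g x. f x * g x), one = const_fun X 1,
     zero = (\<lambda>_. 0), add = (\<lambda>f g x. f x + g x)\<rparr>"

text \<open>The differential of \<open>f\<close> at \<open>p\<close>; on tangent vectors it does not depend on the polynomial
  extension.\<close>

definition differential ::
  "'N::finite pt set \<Rightarrow> ('N pt \<Rightarrow> complex) \<Rightarrow> 'N pt \<Rightarrow> 'N pt \<Rightarrow> complex" where
  "differential X f p v =
     dir_deriv (SOME P. P \<in> poly_fun \<and> (\<forall>x\<in>X. P x = f x)) p v"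

section \<open>Affine Landau-Ginzburg B-models\<close>

text \<open>The second line says that the action map from \<open>\<complex>\<^sup>* \<times> X\<close> is a morphism: its
  coordinates are Laurent polynomials in \<open>l\<close> whose coefficients are regular functions on \<open>X\<close>.\<close>

definition algebraic_Cstar_action ::
  "'N::finite pt set \<Rightarrow> (complex \<Rightarrow> 'N pt \<Rightarrow> 'N pt) \<Rightarrow> bool" where
  "algebraic_Cstar_action X act \<longleftrightarrow>
     (\<forall>l. l \<noteq> 0 \<longrightarrow> act l ` X \<subseteq> X) \<and>
     (\<forall>i. \<exists>K::int. \<exists>P. range P \<subseteq> poly_fun \<and>
        (\<forall>l x. l \<noteq> 0 \<longrightarrow> x \<in> X \<longrightarrow> act l x $ i = (\<Sum>k=-K..K. l powi k * P k x))) \<and>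
     (\<forall>x\<in>X. act 1 x = x) \<and>
     (\<forall>l m x. l \<noteq> 0 \<longrightarrow> m \<noteq> 0 \<longrightarrow> x \<in> X \<longrightarrow> act (l * m) x = act l (act m x))"

definition weight_space ::
  "'N::finite pt set \<Rightarrow> (complex \<Rightarrow> 'N pt \<Rightarrow> 'N pt) \<Rightarrow> int \<Rightarrow> ('N pt \<Rightarrow> complex) set" where
  "weight_space X act d =
     {f \<in> regular X. \<forall>l x. l \<noteq> 0 \<longrightarrow> x \<in> X \<longrightarrow> f (act l x) = l powi d * f x}"

definition affine_LG_model ::
  "nat \<Rightarrow> 'N::finite pt set \<Rightarrow> (complex \<Rightarrow> 'N pt \<Rightarrow> 'N pt) \<Rightarrow> ('N pt \<Rightarrow> complex) \<Rightarrow> bool" where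
  "affine_LG_model n X act W \<longleftrightarrow> smooth_affine_variety n X \<and>
     algebraic_Cstar_action X act \<and> (\<forall>x\<in>X. act (-1) x = x) \<and> W \<in> weight_space X act 2"

definition critical_points ::
  "'N::finite pt set \<Rightarrow> ('N pt \<Rightarrow> complex) \<Rightarrow> 'N pt set" where
  "critical_points X W = {p \<in> X. \<forall>v\<in>tangent X p. differential X W p v = 0}"

definition isolated_singularities ::
  "'N::finite pt set \<Rightarrow> ('N pt \<Rightarrow> complex) \<Rightarrow> bool" where
  "isolated_singularities X W \<longleftrightarrow> finite (critical_points X W)"

section \<open>Graded modules and B-branes\<close>

definition graded_module :: "'N::finite pt set \<Rightarrow> (complex \<Rightarrow> 'N pt \<Rightarrow> 'N pt) \<Rightarrow>
    ('N pt \<Rightarrow> complex, 'm) module \<Rightarrow> (int \<Rightarrow> 'm set) \<Rightarrow> bool" where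
  "graded_module X act M G \<longleftrightarrow> Module.module (coord_ring X) M \<and>
     (\<forall>d. subgroup (G d) (add_monoid M)) \<and>
     (\<forall>a b f m. f \<in> weight_space X act a \<longrightarrow> m \<in> G b \<longrightarrow> f \<odot>\<^bsub>M\<^esub> m \<in> G (a + b)) \<and>
     (\<forall>m\<in>carrier M. \<exists>!h. (\<forall>d. h d \<in> G d) \<and> finite {d. h d \<noteq> \<zero>\<^bsub>M\<^esub>} \<and>
        m = (\<Oplus>\<^bsub>M\<^esub>d\<in>{d. h d \<noteq> \<zero>\<^bsub>M\<^esub>}. h d))"

text \<open>The degree \<open>d\<close> part of the graded space of \<open>R\<close>-linear maps from \<open>(M, G)\<close> to \<open>(N, H)\<close>.\<close>

definition graded_hom :: "('f, 'r) ring_scheme \<Rightarrow> ('f, 'm) module \<Rightarrow> (int \<Rightarrow> 'm set) \<Rightarrow>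
    ('f, 'k) module \<Rightarrow> (int \<Rightarrow> 'k set) \<Rightarrow> int \<Rightarrow> ('m \<Rightarrow> 'k) set" where
  "graded_hom R M G N H d = {f \<in> carrier M \<rightarrow>\<^sub>E carrier N.
     (\<forall>x\<in>carrier M. \<forall>y\<in>carrier M. f (x \<oplus>\<^bsub>M\<^esub> y) = f x \<oplus>\<^bsub>N\<^esub> f y) \<and>
     (\<forall>a\<in>carrier R. \<forall>x\<in>carrier M. f (a \<odot>\<^bsub>M\<^esub> x) = a \<odot>\<^bsub>N\<^esub> f x) \<and>
     (\<forall>e. f ` G e \<subseteq> H (e + d))}"

text \<open>\<open>\<Oplus>\<^sub>i\<^sub><\<^sub>r \<O>\<^sub>X[s i]\<close>; the \<open>module\<close> record also carries a product and a unit, which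
  are irrelevant for modules.\<close>

definition free_module :: "'N::finite pt set \<Rightarrow> nat \<Rightarrow>
    ('N pt \<Rightarrow> complex, nat \<Rightarrow> 'N pt \<Rightarrow> complex) module" where
  "free_module X r = \<lparr>carrier = {v. (\<forall>i<r. v i \<in> regular X) \<and> (\<forall>i\<ge>r. v i = (\<lambda>_. 0))},
     mult = undefined, one = undefined,
     zero = (\<lambda>_ _. 0), add = (\<lambda>u v i x. u i x + v i x), smult = (\<lambda>f v i x. f x * v i x)\<rparr>"

definition free_grading :: "'N::finite pt set \<Rightarrow> (complex \<Rightarrow> 'N pt \<Rightarrow> 'N pt) \<Rightarrow> nat \<Rightarrow>
    (nat \<Rightarrow> int) \<Rightarrow> int \<Rightarrow> (nat \<Rightarrow> 'N pt \<Rightarrow> complex) set" where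
  "free_grading X act r s d =
     {v \<in> carrier (free_module X r). \<forall>i<r. v i \<in> weight_space X act (d + s i)}"

definition basis_vector :: "'N::finite pt set \<Rightarrow> nat \<Rightarrow> nat \<Rightarrow> 'N pt \<Rightarrow> complex" where
  "basis_vector X i = (\<lambda>k. if k = i then const_fun X 1 else (\<lambda>_. 0))"

record ('f, 'm) brane =
  bmod :: "('f, 'm) module"
  bgrad :: "int \<Rightarrow> 'm set"
  bdiff :: "'m \<Rightarrow> 'm"

record ('f, 'm) realization =
  rrank :: nat
  rshift :: "nat \<Rightarrow> int"
  rincl :: "'m \<Rightarrow> nat \<Rightarrow> 'f"
  rproj :: "(nat \<Rightarrow> 'f) \<Rightarrow> 'm"

definition is_realization :: "'N::finite pt set \<Rightarrow> (complex \<Rightarrow> 'N pt \<Rightarrow> 'N pt) \<Rightarrow>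
    ('N pt \<Rightarrow> complex, 'm) module \<Rightarrow> (int \<Rightarrow> 'm set) \<Rightarrow>
    ('N pt \<Rightarrow> complex, 'm) realization \<Rightarrow> bool" where
  "is_realization X act M G \<rho> \<longleftrightarrow>
     (let F = free_module X (rrank \<rho>); H = free_grading X act (rrank \<rho>) (rshift \<rho>) in
      rincl \<rho> \<in> graded_hom (coord_ring X) M G F H 0 \<and>
      rproj \<rho> \<in> graded_hom (coord_ring X) F H M G 0 \<and>
      (\<forall>m\<in>carrier M. rproj \<rho> (rincl \<rho> m) = m))"

text \<open>A graded module is finitely generated projective iff it is a direct summand of a finite
  graded free module. A brane is a module with its grading and the endomorphism \<open>D\<close>; the
  category \<open>Br(X,W)\<close> consists of the branes whose underlying set lives in the type \<open>'m\<close>.\<close>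

definition Br :: "'N::finite pt set \<Rightarrow> (complex \<Rightarrow> 'N pt \<Rightarrow> 'N pt) \<Rightarrow> ('N pt \<Rightarrow> complex) \<Rightarrow>
    ('N pt \<Rightarrow> complex, 'm) brane set" where
  "Br X act W = {M. graded_module X act (bmod M) (bgrad M) \<and>
     (\<exists>\<rho>. is_realization X act (bmod M) (bgrad M) \<rho>) \<and>
     bdiff M \<in> graded_hom (coord_ring X) (bmod M) (bgrad M) (bmod M) (bgrad M) 1 \<and>
     (\<forall>m\<in>carrier (bmod M). bdiff M (bdiff M m) = W \<odot>\<^bsub>bmod M\<^esub> m)}"

definition brane_hom :: "'N::finite pt set \<Rightarrow> ('N pt \<Rightarrow> complex, 'm) brane \<Rightarrow>
    ('N pt \<Rightarrow> complex, 'm) brane \<Rightarrow> int \<Rightarrow> ('m \<Rightarrow> 'm) set" where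
  "brane_hom X M N d = graded_hom (coord_ring X) (bmod M) (bgrad M) (bmod N) (bgrad N) d"

section \<open>Tensor products\<close>

abbreviation cscale :: "complex \<Rightarrow> ('b \<Rightarrow>\<^sub>0 complex) \<Rightarrow> ('b \<Rightarrow>\<^sub>0 complex)" where
  "cscale c x \<equiv> Poly_Mapping.map ((*) c) x"

lemma lookup_cscale: "Poly_Mapping.lookup (cscale c x) b = c * Poly_Mapping.lookup x b"
  by (simp add: Poly_Mapping.map.rep_eq when_def)

interpretation cfree: vector_space "cscale :: complex \<Rightarrow> ('b \<Rightarrow>\<^sub>0 complex) \<Rightarrow> ('b \<Rightarrow>\<^sub>0 complex)"
  by standard (auto intro!: poly_mapping_eqI simp: lookup_cscale lookup_add algebra_simps)

definition lin_ext :: "('a \<Rightarrow> ('b \<Rightarrow>\<^sub>0 complex)) \<Rightarrow> ('a \<Rightarrow>\<^sub>0 complex) \<Rightarrow> ('b \<Rightarrow>\<^sub>0 complex)" where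
  "lin_ext f x = (\<Sum>b\<in>Poly_Mapping.keys x. cscale (Poly_Mapping.lookup x b) (f b))"

text \<open>A (direct sum of) tensor product(s) of complex vector spaces is the free vector space on a
  set \<open>B\<close> of lists, standing for pure tensors, modulo multilinearity in every slot. The
  predicate \<open>adds u v w\<close> says that \<open>u\<close>, \<open>v\<close> lie in the same vector space with sum \<open>w\<close>, and
  \<open>scales c u w\<close> that \<open>w\<close> is \<open>c\<close> times \<open>u\<close>. Elements of the quotient are cosets.\<close>

definition multilinear_relations :: "'a list set \<Rightarrow> ('a \<Rightarrow> 'a \<Rightarrow> 'a \<Rightarrow> bool) \<Rightarrow>
    (complex \<Rightarrow> 'a \<Rightarrow> 'a \<Rightarrow> bool) \<Rightarrow> ('a list \<Rightarrow>\<^sub>0 complex) set" where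
  "multilinear_relations B adds scales = cfree.span
    ({Poly_Mapping.single (xs @ w # ys) 1 - Poly_Mapping.single (xs @ u # ys) 1
        - Poly_Mapping.single (xs @ v # ys) 1 | xs u v w ys.
        adds u v w \<and> xs @ u # ys \<in> B \<and> xs @ v # ys \<in> B \<and> xs @ w # ys \<in> B} \<union>
     {Poly_Mapping.single (xs @ w # ys) 1 - Poly_Mapping.single (xs @ u # ys) c | c xs u w ys.
        scales c u w \<and> xs @ u # ys \<in> B \<and> xs @ w # ys \<in> B})"

definition tensor_class :: "'a list set \<Rightarrow> ('a \<Rightarrow> 'a \<Rightarrow> 'a \<Rightarrow> bool) \<Rightarrow>
    (complex \<Rightarrow> 'a \<Rightarrow> 'a \<Rightarrow> bool) \<Rightarrow> ('a list \<Rightarrow>\<^sub>0 complex) \<Rightarrow> ('a list \<Rightarrow>\<^sub>0 complex) set" where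
  "tensor_class B adds scales x = {y. y - x \<in> multilinear_relations B adds scales}"

text \<open>The coset of \<open>x\<close> in \<open>\<O>\<^sub>X\<close> tensored with itself \<open>k\<close> times, i.e. with \<open>k + 1\<close> factors.\<close>

definition ring_tensor_class :: "'N::finite pt set \<Rightarrow> nat \<Rightarrow>
    (('N pt \<Rightarrow> complex) list \<Rightarrow>\<^sub>0 complex) \<Rightarrow> (('N pt \<Rightarrow> complex) list \<Rightarrow>\<^sub>0 complex) set" where
  "ring_tensor_class X k = tensor_class {fs. length fs = Suc k \<and> set fs \<subseteq> regular X}
     (\<lambda>f g h. h = (\<lambda>x. f x + g x)) (\<lambda>c f h. h = (\<lambda>x. c * f x))"

section \<open>The Hochschild complex of the category of B-branes\<close>

text \<open>A homogeneous morphism together with its source, target and degree. The graded tensor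
  products are generated by tensors of homogeneous morphisms.\<close>

record ('f, 'm) arrow =
  asrc :: "('f, 'm) brane"
  atgt :: "('f, 'm) brane"
  adeg :: int
  amap :: "'m \<Rightarrow> 'm"

definition arrow_add ::
  "('f, 'm) arrow \<Rightarrow> ('f, 'm) arrow \<Rightarrow> ('f, 'm) arrow \<Rightarrow> bool" where
  "arrow_add u v w \<longleftrightarrow> asrc v = asrc u \<and> atgt v = atgt u \<and> adeg v = adeg u \<and>
     w = u\<lparr>amap := restrict (\<lambda>m. amap u m \<oplus>\<^bsub>bmod (atgt u)\<^esub> amap v m) (carrier (bmod (asrc u)))\<rparr>"

definition arrow_scale :: "'N::finite pt set \<Rightarrow> complex \<Rightarrow>
    ('N pt \<Rightarrow> complex, 'm) arrow \<Rightarrow> ('N pt \<Rightarrow> complex, 'm) arrow \<Rightarrow> bool" where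
  "arrow_scale X c u w \<longleftrightarrow>
     w = u\<lparr>amap := restrict (\<lambda>m. const_fun X c \<odot>\<^bsub>bmod (atgt u)\<^esub> amap u m)
            (carrier (bmod (asrc u)))\<rparr>"

definition hochschild_tensors :: "'N::finite pt set \<Rightarrow> (complex \<Rightarrow> 'N pt \<Rightarrow> 'N pt) \<Rightarrow>
    ('N pt \<Rightarrow> complex) \<Rightarrow> nat \<Rightarrow> ('N pt \<Rightarrow> complex, 'm) arrow list set" where
  "hochschild_tensors X act W k = {us. length us = Suc k \<and>
     (\<forall>s\<le>k. asrc (us ! s) \<in> Br X act W \<and> atgt (us ! s) = asrc (us ! (Suc s mod Suc k)) \<and>
        amap (us ! s) \<in> brane_hom X (asrc (us ! s)) (atgt (us ! s)) (adeg (us ! s)))}"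

text \<open>The coset of \<open>x\<close> in the direct sum, over all \<open>M\<^sub>0, \<dots>, M\<^sub>k\<close>, of
  \<open>Hom(M\<^sub>0,M\<^sub>1) \<otimes> \<dots> \<otimes> Hom(M\<^sub>k,M\<^sub>0)\<close>.\<close>

definition hochschild_class :: "'N::finite pt set \<Rightarrow> (complex \<Rightarrow> 'N pt \<Rightarrow> 'N pt) \<Rightarrow>
    ('N pt \<Rightarrow> complex) \<Rightarrow> nat \<Rightarrow> (('N pt \<Rightarrow> complex, 'm) arrow list \<Rightarrow>\<^sub>0 complex) \<Rightarrow>
    (('N pt \<Rightarrow> complex, 'm) arrow list \<Rightarrow>\<^sub>0 complex) set" where
  "hochschild_class X act W k =
     tensor_class (hochschild_tensors X act W k) arrow_add (arrow_scale X)"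

definition endo_chain :: "'N::finite pt set \<Rightarrow> (complex \<Rightarrow> 'N pt \<Rightarrow> 'N pt) \<Rightarrow>
    ('N pt \<Rightarrow> complex) \<Rightarrow> ('N pt \<Rightarrow> complex, 'm) brane \<Rightarrow> int \<Rightarrow> ('m \<Rightarrow> 'm) \<Rightarrow>
    (('N pt \<Rightarrow> complex, 'm) arrow list \<Rightarrow>\<^sub>0 complex) set" where
  "endo_chain X act W M a \<alpha> = hochschild_class X act W 0
     (Poly_Mapping.single [\<lparr>asrc = M, atgt = M, adeg = a, amap = \<alpha>\<rparr>] 1)"

definition brane_diff_arrow :: "('f, 'm) brane \<Rightarrow> ('f, 'm) arrow" where
  "brane_diff_arrow M = \<lparr>asrc = M, atgt = M, adeg = 1, amap = bdiff M\<rparr>"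

text \<open>On length-one chains \<open>T_d(\<alpha>) = \<Sum>\<^sub>s \<alpha> \<otimes> D\<^bsup>\<otimes>s\<^esup>\<close>. As the sum is infinite, the result is
  the family of its components, indexed by \<open>s\<close>. Here and below, \<open>the_elem\<close> of the image of a
  coset is the map induced on the quotient.\<close>

definition T_d :: "'N::finite pt set \<Rightarrow> (complex \<Rightarrow> 'N pt \<Rightarrow> 'N pt) \<Rightarrow> ('N pt \<Rightarrow> complex) \<Rightarrow>
    (('N pt \<Rightarrow> complex, 'm) arrow list \<Rightarrow>\<^sub>0 complex) set \<Rightarrow>
    nat \<Rightarrow> (('N pt \<Rightarrow> complex, 'm) arrow list \<Rightarrow>\<^sub>0 complex) set" where
  "T_d X act W C = (\<lambda>s. the_elem ((\<lambda>x. hochschild_class X act W s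
     (lin_ext (\<lambda>us. Poly_Mapping.single
        (us @ replicate s (brane_diff_arrow (asrc (hd us)))) 1) x)) ` C))"

section \<open>The generalized trace\<close>

text \<open>Maps act on the right, so row \<open>i\<close> of the matrix is the image of the \<open>i\<close>-th generator.\<close>

definition matrix_entry :: "'N::finite pt set \<Rightarrow> ('N pt \<Rightarrow> complex, 'm) realization \<Rightarrow>
    ('N pt \<Rightarrow> complex, 'm) realization \<Rightarrow> ('m \<Rightarrow> 'm) \<Rightarrow> nat \<Rightarrow> nat \<Rightarrow> 'N pt \<Rightarrow> complex" where
  "matrix_entry X \<rho> \<rho>' f i j = rincl \<rho>' (f (rproj \<rho> (basis_vector X i))) j"

text \<open>\<open>\<rho>\<close> is a choice of realizations of all branes. For a homogeneous map of degree \<open>d\<close>, each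
  matrix entry is a map of degree \<open>d\<close> between the shifted copies of \<open>\<O>\<^sub>X\<close>.\<close>

definition trace_tensor :: "'N::finite pt set \<Rightarrow>
    (('N pt \<Rightarrow> complex, 'm) brane \<Rightarrow> ('N pt \<Rightarrow> complex, 'm) realization) \<Rightarrow>
    ('N pt \<Rightarrow> complex, 'm) arrow list \<Rightarrow> (('N pt \<Rightarrow> complex) list \<Rightarrow>\<^sub>0 complex)" where
  "trace_tensor X \<rho> us = (let t = length us - 1 in
     \<Sum>i\<in>(\<Pi>\<^sub>E s\<in>{..t}. {..<rrank (\<rho> (asrc (us ! s)))}).
       Poly_Mapping.single
         (map (\<lambda>s. matrix_entry X (\<rho> (asrc (us ! s))) (\<rho> (atgt (us ! s))) (amap (us ! s))
                     (i s) (i (Suc s mod Suc t))) [0..<Suc t])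
         ((-1) powi (((\<Sum>s\<le>t. adeg (us ! s)) + int t + 1) * rshift (\<rho> (asrc (us ! 0))) (i 0)
             + (\<Sum>s=1..t. rshift (\<rho> (asrc (us ! s))) (i s)))))"

definition gen_trace :: "'N::finite pt set \<Rightarrow>
    (('N pt \<Rightarrow> complex, 'm) brane \<Rightarrow> ('N pt \<Rightarrow> complex, 'm) realization) \<Rightarrow>
    (nat \<Rightarrow> (('N pt \<Rightarrow> complex, 'm) arrow list \<Rightarrow>\<^sub>0 complex) set) \<Rightarrow>
    nat \<Rightarrow> (('N pt \<Rightarrow> complex) list \<Rightarrow>\<^sub>0 complex) set" where
  "gen_trace X \<rho> \<psi> =
     (\<lambda>k. the_elem ((\<lambda>x. ring_tensor_class X k (lin_ext (trace_tensor X \<rho>) x)) ` \<psi> k))"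

section \<open>Differential forms\<close>

text \<open>A form on the smooth variety \<open>X\<close> is given by its values \<open>\<omega> p [v\<^sub>1, \<dots>, v\<^sub>k]\<close> on tangent
  vectors at \<open>p\<close>. The degree \<open>k\<close> component of an inhomogeneous form is its restriction to
  lists of length \<open>k\<close>. In the wedge product \<open>A\<close> runs through the shuffles of the arguments.\<close>

type_synonym 'N form = "'N pt \<Rightarrow> 'N pt list \<Rightarrow> complex"

definition fun_form :: "('N::finite pt \<Rightarrow> complex) \<Rightarrow> 'N form" where
  "fun_form f = (\<lambda>p vs. if vs = [] then f p else 0)"

definition d_form :: "'N::finite pt set \<Rightarrow> ('N pt \<Rightarrow> complex) \<Rightarrow> 'N form" where
  "d_form X f = (\<lambda>p vs. if length vs = 1 \<and> p \<in> X \<and> hd vs \<in> tangent X p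
     then differential X f p (hd vs) else 0)"

definition wedge :: "'N::finite form \<Rightarrow> 'N form \<Rightarrow> 'N form" where
  "wedge \<omega> \<eta> = (\<lambda>p vs. \<Sum>A\<in>Pow {..<length vs}.
     (-1) ^ card {(i, j). i < j \<and> i \<in> {..<length vs} - A \<and> j \<in> A} *
     \<omega> p (nths vs A) * \<eta> p (nths vs ({..<length vs} - A)))"

definition phi_tensor :: "'N::finite pt set \<Rightarrow> ('N pt \<Rightarrow> complex) list \<Rightarrow> 'N form" where
  "phi_tensor X fs = (\<lambda>p vs. 1 / fact (length fs - 1) *
     wedge (fun_form (hd fs)) (foldr wedge (map (d_form X) (tl fs)) (fun_form (const_fun X 1))) p vs)"

definition phi_deg :: "'N::finite pt set \<Rightarrow> (('N pt \<Rightarrow> complex) list \<Rightarrow>\<^sub>0 complex) set \<Rightarrow>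
    'N form" where
  "phi_deg X C = the_elem ((\<lambda>x p vs. \<Sum>fs\<in>Poly_Mapping.keys x.
     Poly_Mapping.lookup x fs * phi_tensor X fs p vs) ` C)"

text \<open>The \<open>k\<close>-form part of \<open>\<phi>\<close> comes from \<open>k + 1\<close> tensor factors.\<close>

definition phi :: "'N::finite pt set \<Rightarrow>
    (nat \<Rightarrow> (('N pt \<Rightarrow> complex) list \<Rightarrow>\<^sub>0 complex) set) \<Rightarrow> 'N form" where
  "phi X \<psi> = (\<lambda>p vs. phi_deg X (\<psi> (length vs)) p vs)"

subsection \<open>Matrices of forms\<close>

definition form_mat_mult :: "nat \<Rightarrow> (nat \<Rightarrow> nat \<Rightarrow> 'N::finite form) \<Rightarrow>
    (nat \<Rightarrow> nat \<Rightarrow> 'N form) \<Rightarrow> nat \<Rightarrow> nat \<Rightarrow> 'N form" where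
  "form_mat_mult r A B = (\<lambda>i j p vs. \<Sum>k<r. wedge (A i k) (B k j) p vs)"

definition form_mat_one :: "'N::finite pt set \<Rightarrow> nat \<Rightarrow> nat \<Rightarrow> 'N form" where
  "form_mat_one X = (\<lambda>i j. if i = j then fun_form (const_fun X 1) else (\<lambda>_ _. 0))"

definition form_mat_pow :: "'N::finite pt set \<Rightarrow> nat \<Rightarrow> (nat \<Rightarrow> nat \<Rightarrow> 'N form) \<Rightarrow> nat \<Rightarrow>
    nat \<Rightarrow> nat \<Rightarrow> 'N form" where
  "form_mat_pow X r A k = (form_mat_mult r A ^^ k) (form_mat_one X)"

definition supertrace :: "nat \<Rightarrow> (nat \<Rightarrow> int) \<Rightarrow> (nat \<Rightarrow> nat \<Rightarrow> 'N::finite form) \<Rightarrow> 'N form" where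
  "supertrace r s B = (\<lambda>p vs. \<Sum>i<r. (-1) powi s i * B i i p vs)"

section \<open>The residue map\<close>

text \<open>Functions \<open>x\<^sub>0, \<dots>, x\<^sub>n\<^sub>-\<^sub>1\<close> that are holomorphic near \<open>p\<close> and whose differentials form a
  basis of the cotangent space of \<open>X\<close> at \<open>p\<close> (of dimension \<open>n\<close>).\<close>

definition local_coordinates :: "nat \<Rightarrow> 'N::finite pt set \<Rightarrow> 'N pt \<Rightarrow>
    (nat \<Rightarrow> 'N pt \<Rightarrow> complex) \<Rightarrow> bool" where
  "local_coordinates n X p x \<longleftrightarrow>
     (\<exists>U. open U \<and> p \<in> U \<and> (\<forall>i<n. \<forall>q\<in>U. \<exists>L. (x i has_derivative L) (at q) \<and>
        (\<forall>c v. L (c *s v) = c * L v))) \<and>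
     (\<forall>v\<in>tangent X p. (\<forall>i<n. dir_deriv (x i) p v = 0) \<longrightarrow> v = 0)"

definition coord_vector_field :: "nat \<Rightarrow> 'N::finite pt set \<Rightarrow> (nat \<Rightarrow> 'N pt \<Rightarrow> complex) \<Rightarrow>
    nat \<Rightarrow> 'N pt \<Rightarrow> 'N pt" where
  "coord_vector_field n X x i q =
     (THE v. v \<in> tangent X q \<and> (\<forall>j<n. dir_deriv (x j) q v = (if j = i then 1 else 0)))"

definition partial_deriv :: "nat \<Rightarrow> 'N::finite pt set \<Rightarrow> (nat \<Rightarrow> 'N pt \<Rightarrow> complex) \<Rightarrow>
    ('N pt \<Rightarrow> complex) \<Rightarrow> nat \<Rightarrow> 'N pt \<Rightarrow> complex" where
  "partial_deriv n X x f i q = differential X f q (coord_vector_field n X x i q)"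

definition torus_cycle :: "nat \<Rightarrow> 'N::finite pt set \<Rightarrow> (nat \<Rightarrow> 'N pt \<Rightarrow> complex) \<Rightarrow> 'N pt \<Rightarrow>
    real \<Rightarrow> real \<Rightarrow> 'N pt set" where
  "torus_cycle n X F p \<delta> \<epsilon> = {q \<in> X \<inter> ball p \<delta>. \<forall>i<n. cmod (F i q) = \<epsilon>}"

definition cube :: "nat \<Rightarrow> (nat \<Rightarrow> real) set" where
  "cube n = (\<Pi>\<^sub>E i\<in>{..<n}. {0..1})"

definition open_cube :: "nat \<Rightarrow> (nat \<Rightarrow> real) set" where
  "open_cube n = (\<Pi>\<^sub>E i\<in>{..<n}. {0<..<1})"

definition cube_partial ::
  "((nat \<Rightarrow> real) \<Rightarrow> 'v::real_normed_vector) \<Rightarrow> nat \<Rightarrow> (nat \<Rightarrow> real) \<Rightarrow> 'v" where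
  "cube_partial \<gamma> j t = vector_derivative (\<lambda>s. \<gamma> (t(j := s))) (at (t j) within {0..1})"

definition C1_cube :: "nat \<Rightarrow> ((nat \<Rightarrow> real) \<Rightarrow> 'v::real_normed_vector) \<Rightarrow> bool" where
  "C1_cube n \<gamma> \<longleftrightarrow> continuous_on (cube n) \<gamma> \<and>
     (\<forall>j<n. (\<forall>t\<in>cube n. (\<lambda>s. \<gamma> (t(j := s))) differentiable (at (t j) within {0..1})) \<and>
            continuous_on (cube n) (cube_partial \<gamma> j))"

text \<open>A decomposition of \<open>\<Gamma> = {\<bar>F\<^sub>0\<bar> = \<dots> = \<bar>F\<^sub>n\<^sub>-\<^sub>1\<bar> = \<epsilon>}\<close> into parametrized \<open>n\<close>-cubes with disjoint
  interiors, compatible with the usual orientation \<open>d(arg F\<^sub>0) \<and> \<dots> \<and> d(arg F\<^sub>n\<^sub>-\<^sub>1) \<ge> 0\<close>; note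
  that \<open>d(arg F) = Im (dF / F)\<close>. Cubes are used because \<open>\<Gamma>\<close> may be singular for
  every \<open>\<epsilon>\<close>, e.g. for \<open>(x + y)\<^sup>3 + (x - y)\<^sup>3\<close>.\<close>

definition oriented_cubes :: "nat \<Rightarrow> (nat \<Rightarrow> 'N::finite pt \<Rightarrow> complex) \<Rightarrow> 'N pt set \<Rightarrow>
    ((nat \<Rightarrow> real) \<Rightarrow> 'N pt) list \<Rightarrow> bool" where
  "oriented_cubes n F \<Gamma> Q \<longleftrightarrow>
     (\<forall>\<gamma>\<in>set Q. C1_cube n \<gamma> \<and> inj_on \<gamma> (open_cube n)) \<and>
     (\<Union>\<gamma>\<in>set Q. \<gamma> ` cube n) = \<Gamma> \<and>
     (\<forall>a b. a < b \<longrightarrow> b < length Q \<longrightarrow> (Q ! a) ` open_cube n \<inter> (Q ! b) ` open_cube n = {}) \<and>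
     (\<forall>\<gamma>\<in>set Q. \<forall>t\<in>open_cube n.
        0 \<le> (\<Sum>\<pi> | \<pi> permutes {..<n}. of_int (sign \<pi>) *
              (\<Prod>i<n. Im (cube_partial (\<lambda>t. F i (\<gamma> t)) (\<pi> i) t / F i (\<gamma> t)))))"

definition cube_integral :: "nat \<Rightarrow> (nat \<Rightarrow> 'N::finite pt \<Rightarrow> complex) \<Rightarrow> 'N form \<Rightarrow>
    ((nat \<Rightarrow> real) \<Rightarrow> 'N pt) \<Rightarrow> complex" where
  "cube_integral n F \<omega> \<gamma> = (LINT t:cube n|Pi\<^sub>M {..<n} (\<lambda>_. lborel).
     \<omega> (\<gamma> t) (map (\<lambda>j. cube_partial \<gamma> j t) [0..<n]) / (\<Prod>i<n. F i (\<gamma> t)))"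

text \<open>\<open>c\<close> is the normalized integral over the cycles around \<open>p\<close>, for all small neighbourhoods
  of \<open>p\<close> and then all small \<open>\<epsilon>\<close>. It is unique: cubes are required for arbitrarily small \<open>\<epsilon>\<close>.\<close>

definition has_local_residue :: "nat \<Rightarrow> 'N::finite pt set \<Rightarrow> (nat \<Rightarrow> 'N pt \<Rightarrow> complex) \<Rightarrow>
    'N pt \<Rightarrow> 'N form \<Rightarrow> complex \<Rightarrow> bool" where
  "has_local_residue n X F p \<omega> c \<longleftrightarrow> (\<forall>\<^sub>F \<delta> in at_right 0.
     (\<exists>\<^sub>F \<epsilon> in at_right 0. \<exists>Q. oriented_cubes n F (torus_cycle n X F p \<delta> \<epsilon>) Q) \<and>
     (\<forall>\<^sub>F \<epsilon> in at_right 0. \<forall>Q. oriented_cubes n F (torus_cycle n X F p \<delta> \<epsilon>) Q \<longrightarrow>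
        1 / (2 * of_real pi * \<i>) ^ n * (\<Sum>\<gamma>\<leftarrow>Q. cube_integral n F \<omega> \<gamma>) = c))"

definition local_residue :: "nat \<Rightarrow> 'N::finite pt set \<Rightarrow> (nat \<Rightarrow> 'N pt \<Rightarrow> complex) \<Rightarrow>
    'N pt \<Rightarrow> 'N form \<Rightarrow> complex" where
  "local_residue n X F p \<omega> = (if \<exists>c. has_local_residue n X F p \<omega> c
     then THE c. has_local_residue n X F p \<omega> c else 0)"

text \<open>Only the \<open>n\<close>-form component of \<open>\<omega>\<close> enters, as forms are evaluated at \<open>n\<close> tangent vectors.
  The coordinates \<open>x p\<close> at each critical point \<open>p\<close> are a parameter.\<close>

definition Res :: "nat \<Rightarrow> 'N::finite pt set \<Rightarrow> ('N pt \<Rightarrow> complex) \<Rightarrow>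
    ('N pt \<Rightarrow> nat \<Rightarrow> 'N pt \<Rightarrow> complex) \<Rightarrow> 'N form \<Rightarrow> complex" where
  "Res n X W x \<omega> = (\<Sum>p\<in>critical_points X W. local_residue n X (partial_deriv n X (x p) W) p \<omega>)"

end

theory Submission
  imports Defs
begin

text \<open>Every stage of the functional is induced by a multilinear map, so it may be evaluated on the
  representatives \<open>\<alpha> \<otimes> D\<^sup>n\<close>; only the \<open>n\<close>-form part reaches the residue. This yields the sum of
  \<open>1/n! \<alpha>\<^bsub>i\<^sub>0i\<^sub>1\<^esub> dD\<^bsub>i\<^sub>1i\<^sub>2\<^esub> \<and> \<dots> \<and> dD\<^bsub>i\<^sub>ni\<^sub>0\<^esub>\<close> over closed paths, up to the signs of the generalized trace.
  Since \<open>-1\<close> acts trivially all weights are even, so along a path with nonzero entries consecutive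
  shifts among \<open>\<sigma>\<^bsub>i\<^sub>1\<^esub>, \<dots>, \<sigma>\<^bsub>i\<^sub>n\<^esub>, \<sigma>\<^bsub>i\<^sub>0\<^esub>\<close> have opposite parities and \<open>|\<alpha>|\<close> has the parity of \<open>n\<close>. The exponent
  of the generalized trace is then congruent to \<open>\<sigma>\<^bsub>i\<^sub>0\<^esub> + n(n+1)/2\<close>, that is to \<open>\<sigma>\<^bsub>i\<^sub>0\<^esub> + \<lceil>n/2\<rceil>\<close>, modulo 2.\<close>

section \<open>Linear extension and multilinear relations\<close>

text \<open>The target space and its scalar multiplication are parameters because two targets occur:
  free vector spaces, where this is \<open>lin_ext\<close>, and the complex numbers, where
  \<open>phi_tensor\<close> is evaluated at a fixed point and fixed vectors.\<close>

definition lin_comb ::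
    "(complex \<Rightarrow> 'v::ab_group_add \<Rightarrow> 'v) \<Rightarrow> ('a \<Rightarrow> 'v) \<Rightarrow> ('a \<Rightarrow>\<^sub>0 complex) \<Rightarrow> 'v" where
  "lin_comb smul f x =
     (\<Sum>b\<in>Poly_Mapping.keys x. smul (Poly_Mapping.lookup x b) (f b))"

lemma lin_ext_eq_lin_comb: "lin_ext f = lin_comb cscale f"
  by (rule ext) (simp add: lin_ext_def lin_comb_def)

lemma vector_space_cscale: "vector_space cscale"
  by (rule cfree.vector_space_axioms)

lemma vector_space_complex: "vector_space ((*) :: complex \<Rightarrow> complex \<Rightarrow> complex)"
  by standard (auto simp: algebra_simps)

text \<open>Keys outside the support have coefficient zero. Additivity needs a common finite index
  set, since cancellation can make the support of \<open>x + y\<close> smaller than the union of the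
  supports.\<close>

lemma lin_comb_superset:
  assumes "vector_space smul" "finite S" "Poly_Mapping.keys x \<subseteq> S"
  shows "lin_comb smul f x = (\<Sum>b\<in>S. smul (Poly_Mapping.lookup x b) (f b))"
proof -
  interpret vector_space smul by fact
  show ?thesis
    unfolding lin_comb_def using assms
    by (intro sum.mono_neutral_left) (auto simp: in_keys_iff)
qed

lemma lin_comb_add:
  assumes "vector_space smul"
  shows "lin_comb smul f (x + y) = lin_comb smul f x + lin_comb smul f y"
proof -
  interpret vector_space smul by fact
  let ?S = "Poly_Mapping.keys x \<union> Poly_Mapping.keys y"
  have *: "finite ?S" "Poly_Mapping.keys (x + y) \<subseteq> ?S"
    by (auto simp: Poly_Mapping.keys_add)
  show ?thesis
    by (simp add: lin_comb_superset[OF assms, of ?S] * lookup_add scale_left_distrib sum.distrib)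
qed

lemma lin_comb_cscale:
  assumes "vector_space smul"
  shows "lin_comb smul f (cscale c x) = smul c (lin_comb smul f x)"
proof -
  interpret vector_space smul by fact
  let ?S = "Poly_Mapping.keys x"
  have *: "finite ?S" "Poly_Mapping.keys (cscale c x) \<subseteq> ?S"
    by (auto simp: in_keys_iff lookup_cscale)
  show ?thesis
    by (simp add: lin_comb_superset[OF assms, of ?S] * lookup_cscale scale_sum_right)
qed

lemma lin_comb_diff:
  assumes "vector_space smul"
  shows "lin_comb smul f (x - y) = lin_comb smul f x - lin_comb smul f y"
  using lin_comb_add[OF assms, of f "x - y" y] by simp

lemma lin_comb_zero: "lin_comb smul f 0 = 0"
  by (simp add: lin_comb_def)

lemma lin_comb_single:
  assumes "vector_space smul"
  shows "lin_comb smul f (Poly_Mapping.single b c) = smul c (f b)"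
proof -
  interpret vector_space smul by fact
  show ?thesis by (simp add: lin_comb_def)
qed

lemma lin_comb_sum:
  assumes "vector_space smul"
  shows "lin_comb smul f (\<Sum>i\<in>I. g i) = (\<Sum>i\<in>I. lin_comb smul f (g i))"
  by (induction I rule: infinite_finite_induct)
     (auto simp: lin_comb_zero lin_comb_add[OF assms])

text \<open>The elements sent into \<open>V\<close> by the linear extension form a subspace, so
  checking generators suffices. \<open>V\<close> is kept general: it is zero when the target is a
  vector space, and the relation subspace when the target is again a tensor product.\<close>

lemma lin_comb_multilinear_relations:
  assumes vs: "vector_space smul" and V: "module.subspace smul V"
    and adds: "\<And>xs u v w ys. adds u v w \<Longrightarrow> xs @ u # ys \<in> B \<Longrightarrow> xs @ v # ys \<in> B \<Longrightarrow>
      xs @ w # ys \<in> B \<Longrightarrow> f (xs @ w # ys) - f (xs @ u # ys) - f (xs @ v # ys) \<in> V"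
    and scales: "\<And>c xs u w ys. scales c u w \<Longrightarrow> xs @ u # ys \<in> B \<Longrightarrow>
      xs @ w # ys \<in> B \<Longrightarrow> f (xs @ w # ys) - smul c (f (xs @ u # ys)) \<in> V"
    and x: "x \<in> multilinear_relations B adds scales"
  shows "lin_comb smul f x \<in> V"
proof -
  interpret vector_space smul by fact
  have "cfree.subspace {x. lin_comb smul f x \<in> V}"
    using V by (auto simp: cfree.subspace_def subspace_def lin_comb_zero lin_comb_add[OF vs]
        lin_comb_cscale[OF vs])
  from x[unfolded multilinear_relations_def] this show ?thesis
    by (rule cfree.span_induct)
       (auto simp: lin_comb_diff[OF vs] lin_comb_single[OF vs] intro: adds scales)
qed

section \<open>Cosets and the maps induced on them\<close>

lemma subspace_multilinear_relations: "cfree.subspace (multilinear_relations B adds scales)"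
  unfolding multilinear_relations_def by (rule cfree.subspace_span)

lemma tensor_class_eqI:
  assumes "y - x \<in> multilinear_relations B adds scales"
  shows "tensor_class B adds scales y = tensor_class B adds scales x"
proof -
  note sub = subspace_multilinear_relations[of B adds scales]
  have "z - y \<in> multilinear_relations B adds scales \<longleftrightarrow>
        z - x \<in> multilinear_relations B adds scales" for z
    using cfree.subspace_add[OF sub _ assms, of "z - y"]
      cfree.subspace_diff[OF sub _ assms, of "z - x"]
    by (metis diff_add_cancel diff_diff_eq2 add_diff_eq)
  then show ?thesis by (auto simp: tensor_class_def)
qed

lemma self_in_tensor_class: "x \<in> tensor_class B adds scales x"
  unfolding tensor_class_def
  using cfree.subspace_0[OF subspace_multilinear_relations, of B adds scales]
  by (metis diff_self mem_Collect_eq)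

text \<open>A function constant on a coset has a one-element image there, cosets being nonempty;
  this turns \<open>the_elem\<close> into evaluation at a representative.\<close>

lemma the_elem_image_tensor_class:
  assumes "\<And>y. y - x \<in> multilinear_relations B adds scales \<Longrightarrow> f y = f x"
  shows "the_elem (f ` tensor_class B adds scales x) = f x"
proof -
  have "f ` tensor_class B adds scales x = {f x}"
    using assms self_in_tensor_class[of x B adds scales]
    unfolding tensor_class_def by blast
  then show ?thesis by simp
qed

lemma lin_comb_eq_on_tensor_class:
  assumes vs: "vector_space smul"
    and adds: "\<And>xs u v w ys. adds u v w \<Longrightarrow> xs @ u # ys \<in> B \<Longrightarrow> xs @ v # ys \<in> B \<Longrightarrow>
      xs @ w # ys \<in> B \<Longrightarrow> f (xs @ w # ys) = f (xs @ u # ys) + f (xs @ v # ys)"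
    and scales: "\<And>c xs u w ys. scales c u w \<Longrightarrow> xs @ u # ys \<in> B \<Longrightarrow>
      xs @ w # ys \<in> B \<Longrightarrow> f (xs @ w # ys) = smul c (f (xs @ u # ys))"
    and x: "y - x \<in> multilinear_relations B adds scales"
  shows "lin_comb smul f y = lin_comb smul f x"
proof -
  interpret vector_space smul by fact
  have "lin_comb smul f (y - x) \<in> {0}"
    by (rule lin_comb_multilinear_relations[OF vs _ _ _ x]) (auto simp: adds scales)
  then show ?thesis by (simp add: lin_comb_diff[OF vs])
qed

text \<open>Here \<open>V\<close> is the relation subspace of the target, so images of equivalent
  chains differ by relations. This serves both \<open>T_d\<close> and
  \<open>gen_trace\<close>.\<close>

lemma the_elem_lin_ext_tensor_class:
  assumes adds: "\<And>xs u v w ys. adds u v w \<Longrightarrow> xs @ u # ys \<in> B \<Longrightarrow> xs @ v # ys \<in> B \<Longrightarrow>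
      xs @ w # ys \<in> B \<Longrightarrow> f (xs @ w # ys) - f (xs @ u # ys) - f (xs @ v # ys)
        \<in> multilinear_relations B' adds' scales'"
    and scales: "\<And>c xs u w ys. scales c u w \<Longrightarrow> xs @ u # ys \<in> B \<Longrightarrow>
      xs @ w # ys \<in> B \<Longrightarrow> f (xs @ w # ys) - cscale c (f (xs @ u # ys))
        \<in> multilinear_relations B' adds' scales'"
  shows "the_elem ((\<lambda>x. tensor_class B' adds' scales' (lin_ext f x)) ` tensor_class B adds scales x)
    = tensor_class B' adds' scales' (lin_ext f x)"
proof (rule the_elem_image_tensor_class, rule tensor_class_eqI)
  fix y assume y: "y - x \<in> multilinear_relations B adds scales"
  have "lin_comb cscale f (y - x) \<in> multilinear_relations B' adds' scales'"
    by (rule lin_comb_multilinear_relations[OF vector_space_cscale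
          subspace_multilinear_relations _ _ y]) (fact adds, fact scales)
  then show "lin_ext f y - lin_ext f x \<in> multilinear_relations B' adds' scales'"
    by (simp add: lin_ext_eq_lin_comb lin_comb_diff[OF vector_space_cscale])
qed

section \<open>Regular functions and their differentials\<close>

lemma poly_fun_line_differentiable:
  assumes "P \<in> poly_fun"
  shows "(\<lambda>t. P (p + t *s v)) field_differentiable at t"
  using assms by induction (auto intro!: derivative_intros)

lemma dir_deriv_add:
  assumes "P \<in> poly_fun" "Q \<in> poly_fun"
  shows "dir_deriv (\<lambda>x. P x + Q x) p v = dir_deriv P p v + dir_deriv Q p v"
  unfolding dir_deriv_def
  using assms by (intro deriv_add poly_fun_line_differentiable)

lemma dir_deriv_cmult:
  assumes "P \<in> poly_fun"
  shows "dir_deriv (\<lambda>x. c * P x) p v = c * dir_deriv P p v"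
  unfolding dir_deriv_def
  using assms by (intro deriv_cmult poly_fun_line_differentiable)

lemma poly_fun_cmult: "P \<in> poly_fun \<Longrightarrow> (\<lambda>x. c * P x) \<in> poly_fun"
  by (rule poly_fun.mult[OF poly_fun.const])

lemma regular_outside: "f \<in> regular X \<Longrightarrow> x \<notin> X \<Longrightarrow> f x = 0"
  by (auto simp: regular_def)

lemma regular_const_fun: "const_fun X c \<in> regular X"
  unfolding regular_def const_fun_def using poly_fun.const[of c] by auto

lemma regular_0: "(\<lambda>_. 0) \<in> regular X"
  using regular_const_fun[of X 0] by (simp add: const_fun_def)

text \<open>The difference of \<open>P\<close> and \<open>Q\<close> vanishes on \<open>X\<close>,
  and tangent vectors by definition annihilate such polynomials. This makes the choice of extension
  in \<open>differential\<close> immaterial.\<close>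

lemma dir_deriv_eq_on_tangent:
  assumes "P \<in> poly_fun" "Q \<in> poly_fun" "\<forall>x\<in>X. P x = Q x" "v \<in> tangent X p"
  shows "dir_deriv P p v = dir_deriv Q p v"
proof -
  \<comment> \<open>The set \<open>poly_fun\<close> is generated by sums and products, so the
    difference is written with the factor -1.\<close>
  let ?R = "\<lambda>x. P x + (-1) * Q x"
  have "?R \<in> poly_fun" by (intro poly_fun.add poly_fun_cmult assms)
  then have "dir_deriv ?R p v = 0" using assms by (auto simp: tangent_def)
  then show ?thesis
    using assms dir_deriv_add[OF assms(1) poly_fun_cmult[OF assms(2)], of "-1" p v]
      dir_deriv_cmult[OF assms(2), of "-1" p v] by simp
qed

lemma differential_eq_dir_deriv:
  assumes "P \<in> poly_fun" "\<forall>x\<in>X. P x = f x" "v \<in> tangent X p"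
  shows "differential X f p v = dir_deriv P p v"
proof -
  have "(SOME P. P \<in> poly_fun \<and> (\<forall>x\<in>X. P x = f x)) \<in> poly_fun \<and>
        (\<forall>x\<in>X. (SOME P. P \<in> poly_fun \<and> (\<forall>x\<in>X. P x = f x)) x = f x)"
    using assms by (intro someI_ex[of "\<lambda>P. P \<in> poly_fun \<and> (\<forall>x\<in>X. P x = f x)"]) auto
  then show ?thesis
    unfolding differential_def using assms by (intro dir_deriv_eq_on_tangent[where X = X]) auto
qed

text \<open>Polynomial extensions of \<open>f\<close> and \<open>g\<close> add up to one of the sum,
  so additivity of \<open>dir_deriv\<close> carries over; off tangent vectors all terms are
  zero.\<close>

lemma d_form_add:
  assumes "f \<in> regular X" "g \<in> regular X"
  shows "d_form X (\<lambda>x. f x + g x) = (\<lambda>p vs. d_form X f p vs + d_form X g p vs)"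
proof -
  obtain P Q where P: "P \<in> poly_fun" "\<forall>x\<in>X. P x = f x" and Q: "Q \<in> poly_fun" "\<forall>x\<in>X. Q x = g x"
    using assms by (auto simp: regular_def)
  have "differential X (\<lambda>x. f x + g x) p v = differential X f p v + differential X g p v"
    if "v \<in> tangent X p" for p v
    using that P Q differential_eq_dir_deriv[OF poly_fun.add[OF P(1) Q(1)], of X "\<lambda>x. f x + g x" v p]
      differential_eq_dir_deriv[OF P that] differential_eq_dir_deriv[OF Q that]
    by (simp add: dir_deriv_add)
  then show ?thesis by (auto simp: d_form_def fun_eq_iff)
qed

lemma d_form_cmult:
  assumes "f \<in> regular X"
  shows "d_form X (\<lambda>x. c * f x) = (\<lambda>p vs. c * d_form X f p vs)"
proof -
  obtain P where P: "P \<in> poly_fun" "\<forall>x\<in>X. P x = f x"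
    using assms by (auto simp: regular_def)
  have "differential X (\<lambda>x. c * f x) p v = c * differential X f p v"
    if "v \<in> tangent X p" for p v
    using that P differential_eq_dir_deriv[OF poly_fun_cmult[OF P(1)], of X c "\<lambda>x. c * f x" v p]
      differential_eq_dir_deriv[OF P that]
    by (simp add: dir_deriv_cmult)
  then show ?thesis by (auto simp: d_form_def fun_eq_iff)
qed

section \<open>Wedge products\<close>

lemma wedge_add_left:
  "wedge (\<lambda>p vs. a p vs + b p vs) \<eta> = (\<lambda>p vs. wedge a \<eta> p vs + wedge b \<eta> p vs)"
  by (simp add: wedge_def fun_eq_iff algebra_simps sum.distrib)

lemma wedge_add_right:
  "wedge \<omega> (\<lambda>p vs. a p vs + b p vs) = (\<lambda>p vs. wedge \<omega> a p vs + wedge \<omega> b p vs)"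
  by (simp add: wedge_def fun_eq_iff algebra_simps sum.distrib)

lemma wedge_cmult_left: "wedge (\<lambda>p vs. c * a p vs) \<eta> = (\<lambda>p vs. c * wedge a \<eta> p vs)"
  by (simp add: wedge_def fun_eq_iff sum_distrib_left algebra_simps)

lemma wedge_cmult_right: "wedge \<omega> (\<lambda>p vs. c * a p vs) = (\<lambda>p vs. c * wedge \<omega> a p vs)"
  by (simp add: wedge_def fun_eq_iff sum_distrib_left algebra_simps)

lemma wedge_0_right: "wedge \<omega> (\<lambda>_ _. 0) = (\<lambda>_ _. 0)"
  by (simp add: wedge_def fun_eq_iff)

lemma wedge_sum_right: "wedge \<omega> (\<lambda>p vs. \<Sum>i\<in>I. a i p vs) = (\<lambda>p vs. \<Sum>i\<in>I. wedge \<omega> (a i) p vs)"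
  by (induction I rule: infinite_finite_induct)
     (simp_all add: wedge_0_right wedge_add_right)

lemma foldr_wedge_add:
  "foldr wedge (os @ (\<lambda>p vs. a p vs + b p vs) # os') \<eta> =
    (\<lambda>p vs. foldr wedge (os @ a # os') \<eta> p vs + foldr wedge (os @ b # os') \<eta> p vs)"
  by (induction os) (simp_all add: wedge_add_left wedge_add_right)

lemma foldr_wedge_cmult:
  "foldr wedge (os @ (\<lambda>p vs. c * a p vs) # os') \<eta> =
    (\<lambda>p vs. c * foldr wedge (os @ a # os') \<eta> p vs)"
  by (induction os) (simp_all add: wedge_cmult_left wedge_cmult_right)

lemma phi_tensor_Cons:
  "phi_tensor X (f # fs) = (\<lambda>p vs. 1 / fact (length fs) *
     wedge (fun_form f) (foldr wedge (map (d_form X) fs) (fun_form (const_fun X 1))) p vs)"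
  by (simp add: phi_tensor_def)

lemma fun_form_add: "fun_form (\<lambda>x. f x + g x) = (\<lambda>p vs. fun_form f p vs + fun_form g p vs)"
  and fun_form_cmult: "fun_form (\<lambda>x. c * f x) = (\<lambda>p vs. c * fun_form f p vs)"
  by (auto simp: fun_form_def fun_eq_iff)

lemma phi_tensor_add:
  assumes "f \<in> regular X" "g \<in> regular X"
  shows "phi_tensor X (xs @ (\<lambda>x. f x + g x) # ys) p vs =
    phi_tensor X (xs @ f # ys) p vs + phi_tensor X (xs @ g # ys) p vs"
  using assms
  \<comment> \<open>The first slot enters as a function and every later one through its
    differential, hence the split on whether \<open>xs\<close> is empty.\<close>
  by (cases xs) (simp_all add: phi_tensor_Cons d_form_add foldr_wedge_add fun_form_add wedge_add_left
      wedge_add_right add_divide_distrib del: foldr_append fact_Suc)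

lemma phi_tensor_cmult:
  assumes "f \<in> regular X"
  shows "phi_tensor X (xs @ (\<lambda>x. c * f x) # ys) p vs = c * phi_tensor X (xs @ f # ys) p vs"
  using assms
  by (cases xs) (simp_all add: phi_tensor_Cons d_form_cmult foldr_wedge_cmult fun_form_cmult
      wedge_cmult_left wedge_cmult_right del: foldr_append fact_Suc)

text \<open>A zero entry is zero times itself, so homogeneity in that slot kills the tensor. This
  discards index paths along which a matrix entry vanishes.\<close>

lemma phi_tensor_0:
  assumes "(\<lambda>_. 0) \<in> set fs"
  shows "phi_tensor X fs p vs = 0"
proof -
  obtain xs ys where "fs = xs @ (\<lambda>_. 0) # ys"
    using assms by (metis split_list)
  then show ?thesis
    using phi_tensor_cmult[OF regular_0, of X xs 0 ys p vs] by simp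
qed

text \<open>Since \<open>phi_tensor\<close> is multilinear in regular functions, the form computed
  from a representative is constant on the coset.\<close>

lemma phi_deg_ring_tensor_class:
  "phi_deg X (ring_tensor_class X k x) p vs = lin_comb (*) (\<lambda>fs. phi_tensor X fs p vs) x"
proof -
  have "the_elem ((\<lambda>x p vs. lin_comb (*) (\<lambda>fs. phi_tensor X fs p vs) x) ` ring_tensor_class X k x)
     = (\<lambda>p vs. lin_comb (*) (\<lambda>fs. phi_tensor X fs p vs) x)"
    unfolding ring_tensor_class_def
    by (intro the_elem_image_tensor_class ext,
        rule lin_comb_eq_on_tensor_class[OF vector_space_complex])
       (auto simp: phi_tensor_add phi_tensor_cmult)
  then show ?thesis
    unfolding phi_deg_def lin_comb_def by simp
qed

section \<open>Matrix entries of homogeneous maps\<close>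

lemma graded_hom_closed:
  "f \<in> graded_hom R M G N H d \<Longrightarrow> x \<in> carrier M \<Longrightarrow> f x \<in> carrier N"
  by (auto simp: graded_hom_def)

lemma graded_hom_degree:
  "f \<in> graded_hom R M G N H d \<Longrightarrow> x \<in> G e \<Longrightarrow> f x \<in> H (e + d)"
  unfolding graded_hom_def by blast

lemma graded_hom_add:
  "f \<in> graded_hom R M G N H d \<Longrightarrow> x \<in> carrier M \<Longrightarrow> y \<in> carrier M \<Longrightarrow>
    f (x \<oplus>\<^bsub>M\<^esub> y) = f x \<oplus>\<^bsub>N\<^esub> f y"
  by (auto simp: graded_hom_def)

lemma graded_hom_smult:
  "f \<in> graded_hom R M G N H d \<Longrightarrow> c \<in> carrier R \<Longrightarrow> x \<in> carrier M \<Longrightarrow>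
    f (c \<odot>\<^bsub>M\<^esub> x) = c \<odot>\<^bsub>N\<^esub> f x"
  by (auto simp: graded_hom_def)

lemma basis_vector_carrier: "i < r \<Longrightarrow> basis_vector X i \<in> carrier (free_module X r)"
  by (auto simp: basis_vector_def free_module_def regular_const_fun regular_0)

lemma free_module_component_regular: "v \<in> carrier (free_module X r) \<Longrightarrow> v i \<in> regular X"
  using regular_0 by (cases "i < r") (auto simp: free_module_def)

lemma is_realization_incl:
  "is_realization X act M G \<rho> \<Longrightarrow> rincl \<rho> \<in> graded_hom (coord_ring X) M G
    (free_module X (rrank \<rho>)) (free_grading X act (rrank \<rho>) (rshift \<rho>)) 0"
  by (simp add: is_realization_def Let_def)

lemma is_realization_proj:
  "is_realization X act M G \<rho> \<Longrightarrow> rproj \<rho> \<in> graded_hom (coord_ring X)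
    (free_module X (rrank \<rho>)) (free_grading X act (rrank \<rho>) (rshift \<rho>)) M G 0"
  by (simp add: is_realization_def Let_def)

lemma rproj_basis_vector_carrier:
  "is_realization X act M G \<rho> \<Longrightarrow> i < rrank \<rho> \<Longrightarrow> rproj \<rho> (basis_vector X i) \<in> carrier M"
  by (rule graded_hom_closed[OF is_realization_proj basis_vector_carrier])

lemma matrix_entry_regular:
  assumes "is_realization X act M G \<rho>" "is_realization X act N H \<rho>'"
    "f \<in> graded_hom (coord_ring X) M G N H d" "i < rrank \<rho>"
  shows "matrix_entry X \<rho> \<rho>' f i j \<in> regular X"
  unfolding matrix_entry_def
  by (rule free_module_component_regular[OF graded_hom_closed[OF is_realization_incl[OF assms(2)]
        graded_hom_closed[OF assms(3) rproj_basis_vector_carrier[OF assms(1,4)]]]])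

lemma matrix_entry_add:
  assumes "is_realization X act M G \<rho>" "is_realization X act N H \<rho>'"
    and f: "f \<in> graded_hom (coord_ring X) M G N H d"
    and g: "g \<in> graded_hom (coord_ring X) M G N H d" and i: "i < rrank \<rho>"
  shows "matrix_entry X \<rho> \<rho>' (restrict (\<lambda>m. f m \<oplus>\<^bsub>N\<^esub> g m) (carrier M)) i j =
    (\<lambda>x. matrix_entry X \<rho> \<rho>' f i j x + matrix_entry X \<rho> \<rho>' g i j x)"
proof -
  note m = rproj_basis_vector_carrier[OF assms(1) i]
  show ?thesis
    using m graded_hom_add[OF is_realization_incl[OF assms(2)] graded_hom_closed[OF f m]
        graded_hom_closed[OF g m]]
    by (simp add: matrix_entry_def free_module_def)
qed

lemma matrix_entry_scale:
  assumes "is_realization X act M G \<rho>" "is_realization X act N H \<rho>'"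
    and f: "f \<in> graded_hom (coord_ring X) M G N H d" and i: "i < rrank \<rho>"
  shows "matrix_entry X \<rho> \<rho>' (restrict (\<lambda>m. const_fun X c \<odot>\<^bsub>N\<^esub> f m) (carrier M)) i j =
    (\<lambda>x. c * matrix_entry X \<rho> \<rho>' f i j x)"
proof -
  note m = rproj_basis_vector_carrier[OF assms(1) i]
  have "const_fun X c \<in> carrier (coord_ring X)"
    by (simp add: coord_ring_def regular_const_fun)
  then have "matrix_entry X \<rho> \<rho>' (restrict (\<lambda>m. const_fun X c \<odot>\<^bsub>N\<^esub> f m) (carrier M)) i j =
    (\<lambda>x. const_fun X c x * matrix_entry X \<rho> \<rho>' f i j x)"
    using m graded_hom_smult[OF is_realization_incl[OF assms(2)] _ graded_hom_closed[OF f m],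
        of "const_fun X c"]
    by (simp add: matrix_entry_def free_module_def)
  \<comment> \<open>The scalar acts through \<open>const_fun X c\<close>, which is \<open>c\<close>
    on \<open>X\<close> and zero elsewhere; the entry is zero off \<open>X\<close> too, so both
    products agree.\<close>
  then show ?thesis
    using regular_outside[OF matrix_entry_regular[OF assms]]
    by (auto simp: const_fun_def fun_eq_iff)
qed

text \<open>The \<open>i\<close>-th generator of the free module sits in degree minus its shift.
  Projection and inclusion preserve degrees and \<open>f\<close> adds \<open>d\<close>; component
  \<open>j\<close> then has its own shift added to the weight.\<close>

lemma matrix_entry_weight_space:
  assumes act: "algebraic_Cstar_action X act"
    and \<rho>: "is_realization X act M G \<rho>" and \<rho>': "is_realization X act N H \<rho>'"
    and f: "f \<in> graded_hom (coord_ring X) M G N H d" and i: "i < rrank \<rho>" and j: "j < rrank \<rho>'"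
  shows "matrix_entry X \<rho> \<rho>' f i j \<in> weight_space X act (d + rshift \<rho>' j - rshift \<rho> i)"
proof -
  have X: "act l x \<in> X" if "l \<noteq> 0" "x \<in> X" for l x
    using act that by (auto simp: algebraic_Cstar_action_def)
  \<comment> \<open>Component \<open>i\<close> is the constant 1 on \<open>X\<close>, of weight zero
    because the action preserves \<open>X\<close>; the other components are zero and so have every
    weight.\<close>
  have "basis_vector X i k \<in> weight_space X act (- rshift \<rho> i + rshift \<rho> k)" for k
    using X regular_const_fun[of X 1] regular_0[of X]
    by (auto simp: basis_vector_def weight_space_def const_fun_def)
  then have "basis_vector X i \<in> free_grading X act (rrank \<rho>) (rshift \<rho>) (- rshift \<rho> i)"
    using basis_vector_carrier[OF i] by (auto simp: free_grading_def)
  then have "rincl \<rho>' (f (rproj \<rho> (basis_vector X i))) \<in>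
      free_grading X act (rrank \<rho>') (rshift \<rho>') (- rshift \<rho> i + 0 + d + 0)"
    by (intro graded_hom_degree[OF is_realization_incl[OF \<rho>']] graded_hom_degree[OF f]
        graded_hom_degree[OF is_realization_proj[OF \<rho>]])
  then show ?thesis
    using j by (auto simp: free_grading_def matrix_entry_def algebra_simps)
qed

text \<open>The weight condition at -1 gives \<open>f x = - f x\<close> on \<open>X\<close>; off
  \<open>X\<close> regular functions are zero by convention.\<close>

lemma weight_space_odd:
  assumes "\<forall>x\<in>X. act (-1) x = x" "f \<in> weight_space X act d" "odd d"
  shows "f = (\<lambda>_. 0)"
proof
  fix x
  have f: "f \<in> regular X" "\<And>x. x \<in> X \<Longrightarrow> f (act (-1) x) = (-1) powi d * f x"
    using assms(2) by (simp_all add: weight_space_def)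
  show "f x = 0"
  proof (cases "x \<in> X")
    case True
    then have "f x = - f x"
      using f(2)[OF True] assms(1,3) by (metis power_int_minus_left_odd power_int_1_left mult_minus1)
    then show ?thesis by simp
  qed (rule regular_outside[OF f(1)])
qed

section \<open>Well-definedness on Hochschild chains\<close>

lemma multilinear_relations_add:
  assumes "adds u v w" "xs @ u # ys \<in> B" "xs @ v # ys \<in> B" "xs @ w # ys \<in> B"
  shows "Poly_Mapping.single (xs @ w # ys) 1 - Poly_Mapping.single (xs @ u # ys) 1
    - Poly_Mapping.single (xs @ v # ys) 1 \<in> multilinear_relations B adds scales"
  unfolding multilinear_relations_def using assms by (intro cfree.span_base UnI1) blast

lemma multilinear_relations_scale:
  assumes "scales c u w" "xs @ u # ys \<in> B" "xs @ w # ys \<in> B"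
  shows "Poly_Mapping.single (xs @ w # ys) 1 - Poly_Mapping.single (xs @ u # ys) c
    \<in> multilinear_relations B adds scales"
  unfolding multilinear_relations_def using assms by (intro cfree.span_base UnI2) blast

lemma cscale_single: "cscale c (Poly_Mapping.single b d) = Poly_Mapping.single b (c * d)"
  by (rule poly_mapping_eqI) (simp add: lookup_cscale lookup_single when_def)

section \<open>Appending copies of the differential\<close>

lemma brane_diff_arrow_simps:
  "asrc (brane_diff_arrow M) = M" "atgt (brane_diff_arrow M) = M"
  "adeg (brane_diff_arrow M) = 1" "amap (brane_diff_arrow M) = bdiff M"
  by (simp_all add: brane_diff_arrow_def)

text \<open>A cyclic tensor of length one is an endomorphism of its source, so loops at that brane
  can follow it and the wrap-around to the first slot matches.\<close>

lemma hochschild_tensors_append_diff: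
  assumes "M \<in> Br X act W" "[u] \<in> hochschild_tensors X act W 0" "asrc u = M"
  shows "u # replicate s (brane_diff_arrow M) \<in> hochschild_tensors X act W s"
proof -
  let ?us = "u # replicate s (brane_diff_arrow M)"
  have u: "atgt u = M" "amap u \<in> brane_hom X M M (adeg u)"
    using assms by (auto simp: hochschild_tensors_def)
  have D: "bdiff M \<in> brane_hom X M M 1"
    using assms(1) by (simp add: Br_def brane_hom_def)
  have nth: "?us ! k = (if k = 0 then u else brane_diff_arrow M)" if "k \<le> s" for k
    using that by (cases k) auto
  have "Suc k mod Suc s \<le> s" for k
    using mod_less_divisor[of "Suc s" "Suc k"] by linarith
  then show ?thesis
    using assms u D brane_diff_arrow_simps[of M] by (auto simp: hochschild_tensors_def nth)
qed

lemma lin_ext_single: "lin_ext f (Poly_Mapping.single b 1) = f b"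
  by (simp add: lin_ext_eq_lin_comb lin_comb_single[OF vector_space_cscale])

text \<open>Arrows related by \<open>arrow_add\<close> or \<open>arrow_scale\<close> share their
  source, hence receive the same tail of differentials; a relation between length-one chains becomes
  a relation in the first slot.\<close>

lemma T_d_endo_chain:
  fixes M :: "('N::finite pt \<Rightarrow> complex, 'm) brane"
  assumes "M \<in> Br X act W" "\<alpha> \<in> brane_hom X M M a"
  shows "T_d X act W (endo_chain X act W M a \<alpha>) s = hochschild_class X act W s
    (Poly_Mapping.single (\<lparr>asrc = M, atgt = M, adeg = a, amap = \<alpha>\<rparr> #
      replicate s (brane_diff_arrow M)) 1)"
proof -
  let ?f = "\<lambda>us :: ('N pt \<Rightarrow> complex, 'm) arrow list.
    Poly_Mapping.single (us @ replicate s (brane_diff_arrow (asrc (hd us)))) (1 :: complex)"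
  let ?x = "Poly_Mapping.single [\<lparr>asrc = M, atgt = M, adeg = a, amap = \<alpha>\<rparr>] (1 :: complex)"
  let ?R = "multilinear_relations (hochschild_tensors X act W s) arrow_add (arrow_scale X)"
  have nil: "xs = [] \<and> ys = []" if "xs @ u # ys \<in> hochschild_tensors X act W 0"
    for xs ys and u :: "('N pt \<Rightarrow> complex, 'm) arrow"
    using that by (auto simp: hochschild_tensors_def)
  have ext: "u # replicate s (brane_diff_arrow (asrc u)) \<in> hochschild_tensors X act W s"
    if "[u] \<in> hochschild_tensors X act W 0" for u :: "('N pt \<Rightarrow> complex, 'm) arrow"
    using that by (intro hochschild_tensors_append_diff) (auto simp: hochschild_tensors_def)
  have adds: "?f (xs @ w # ys) - ?f (xs @ u # ys) - ?f (xs @ v # ys) \<in> ?R"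
    if "arrow_add u v w" "xs @ u # ys \<in> hochschild_tensors X act W 0"
      "xs @ v # ys \<in> hochschild_tensors X act W 0" "xs @ w # ys \<in> hochschild_tensors X act W 0"
    for xs u v w ys
  proof -
    have "xs = []" "ys = []" "asrc v = asrc u" "asrc w = asrc u"
      using nil[OF that(2)] that(1) by (auto simp: arrow_add_def)
    then show ?thesis
      using multilinear_relations_add[of arrow_add u v w "[]"
          "replicate s (brane_diff_arrow (asrc u))" "hochschild_tensors X act W s" "arrow_scale X"]
        that ext[of u] ext[of v] ext[of w] by simp
  qed
  have scales: "?f (xs @ w # ys) - cscale c (?f (xs @ u # ys)) \<in> ?R"
    if "arrow_scale X c u w" "xs @ u # ys \<in> hochschild_tensors X act W 0"
      "xs @ w # ys \<in> hochschild_tensors X act W 0" for c xs u w ys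
  proof -
    have "xs = []" "ys = []" "asrc w = asrc u"
      using nil[OF that(2)] that(1) by (auto simp: arrow_scale_def)
    then show ?thesis
      using multilinear_relations_scale[of "arrow_scale X" c u w "[]"
          "replicate s (brane_diff_arrow (asrc u))" "hochschild_tensors X act W s" arrow_add]
        that ext[of u] ext[of w] by (simp add: cscale_single)
  qed
  have "T_d X act W (endo_chain X act W M a \<alpha>) s = hochschild_class X act W s (lin_ext ?f ?x)"
    unfolding T_d_def endo_chain_def hochschild_class_def
    by (rule the_elem_lin_ext_tensor_class) (fact adds, fact scales)
  then show ?thesis by (simp add: lin_ext_single)
qed

section \<open>The generalized trace on Hochschild classes\<close>

definition trace_entries :: "'N::finite pt set \<Rightarrow>
    (('N pt \<Rightarrow> complex, 'm) brane \<Rightarrow> ('N pt \<Rightarrow> complex, 'm) realization) \<Rightarrow>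
    ('N pt \<Rightarrow> complex, 'm) arrow list \<Rightarrow> (nat \<Rightarrow> nat) \<Rightarrow> ('N pt \<Rightarrow> complex) list" where
  "trace_entries X \<rho> us i = map (\<lambda>s. matrix_entry X (\<rho> (asrc (us ! s))) (\<rho> (atgt (us ! s)))
     (amap (us ! s)) (i s) (i (Suc s mod length us))) [0..<length us]"

text \<open>The exponent is separated from the entries because it involves only sources and degrees,
  so it stays fixed when the map in one slot varies.\<close>

definition trace_exponent ::
    "(('f, 'm) brane \<Rightarrow> ('f, 'm) realization) \<Rightarrow> ('f, 'm) arrow list \<Rightarrow> (nat \<Rightarrow> nat) \<Rightarrow> int" where
  "trace_exponent \<rho> us i = (let t = length us - 1 in
     ((\<Sum>s\<le>t. adeg (us ! s)) + int t + 1) * rshift (\<rho> (asrc (us ! 0))) (i 0)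
       + (\<Sum>s=1..t. rshift (\<rho> (asrc (us ! s))) (i s)))"

lemma trace_tensor_eq:
  assumes "us \<noteq> []"
  shows "trace_tensor X \<rho> us =
    (\<Sum>i\<in>(\<Pi>\<^sub>E s\<in>{..length us - 1}. {..<rrank (\<rho> (asrc (us ! s)))}).
      Poly_Mapping.single (trace_entries X \<rho> us i) ((-1) powi trace_exponent \<rho> us i))"
proof -
  have "Suc (length us - 1) = length us" using assms by simp
  then show ?thesis
    by (simp only: trace_tensor_def trace_entries_def trace_exponent_def Let_def)
qed

lemma nth_append_Cons_cong:
  assumes "g w = g u"
  shows "g ((xs @ w # ys) ! s) = g ((xs @ u # ys) ! s)"
  using assms by (simp add: nth_append nth_Cons split: nat.split)

text \<open>Only position \<open>length xs\<close> sees the map of the exchanged arrow. Prefix and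
  suffix are expressed through \<open>u\<close>, so lists for different arrows share them literally,
  as the multilinear relations require.\<close>

lemma trace_entries_replace:
  assumes "asrc w = asrc u" "atgt w = atgt u"
  shows "trace_entries X \<rho> (xs @ w # ys) i =
    take (length xs) (trace_entries X \<rho> (xs @ u # ys) i) @
      matrix_entry X (\<rho> (asrc u)) (\<rho> (atgt u)) (amap w) (i (length xs))
        (i (Suc (length xs) mod length (xs @ u # ys))) #
      drop (Suc (length xs)) (trace_entries X \<rho> (xs @ u # ys) i)" (is "_ = ?rhs")
proof -
  let ?L = "trace_entries X \<rho> (xs @ u # ys) i"
  let ?e = "matrix_entry X (\<rho> (asrc u)) (\<rho> (atgt u)) (amap w) (i (length xs))
        (i (Suc (length xs) mod length (xs @ u # ys)))"
  have len: "length ?L = length (xs @ u # ys)" by (simp add: trace_entries_def)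
  have "?rhs = ?L[length xs := ?e]"
    using len by (simp add: upd_conv_take_nth_drop)
  also have "\<dots> = trace_entries X \<rho> (xs @ w # ys) i"
  proof (rule nth_equalityI)
    show "length (?L[length xs := ?e]) = length (trace_entries X \<rho> (xs @ w # ys) i)"
      by (simp add: trace_entries_def)
    fix s assume "s < length (?L[length xs := ?e])"
    then have s: "s < length (xs @ u # ys)" using len by simp
    show "?L[length xs := ?e] ! s = trace_entries X \<rho> (xs @ w # ys) i ! s"
    proof (cases "s = length xs")
      case True
      then show ?thesis using s assms by (simp add: trace_entries_def del: upt_Suc)
    next
      case False
      then have "(xs @ w # ys) ! s = (xs @ u # ys) ! s"
        by (simp add: nth_append nth_Cons split: nat.split)
      then show ?thesis using False s by (simp add: trace_entries_def del: upt_Suc)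
    qed
  qed
  finally show ?thesis by simp
qed

text \<open>Index set and exponent are stated for \<open>u\<close>, so that the traces of related
  arrows become sums over one index set with equal signs.\<close>

lemma trace_tensor_replace:
  assumes "asrc w = asrc u" "adeg w = adeg u"
  shows "trace_tensor X \<rho> (xs @ w # ys) =
    (\<Sum>i\<in>(\<Pi>\<^sub>E s\<in>{..length (xs @ u # ys) - 1}. {..<rrank (\<rho> (asrc ((xs @ u # ys) ! s)))}).
      Poly_Mapping.single (trace_entries X \<rho> (xs @ w # ys) i)
        ((-1) powi trace_exponent \<rho> (xs @ u # ys) i))"
proof -
  have src: "asrc ((xs @ w # ys) ! s) = asrc ((xs @ u # ys) ! s)" for s
    by (rule nth_append_Cons_cong) fact
  have deg: "adeg ((xs @ w # ys) ! s) = adeg ((xs @ u # ys) ! s)" for s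
    by (rule nth_append_Cons_cong) fact
  have len: "length (xs @ w # ys) = length (xs @ u # ys)" by simp
  have "trace_exponent \<rho> (xs @ w # ys) = trace_exponent \<rho> (xs @ u # ys)"
    unfolding trace_exponent_def src deg len ..
  moreover have "xs @ w # ys \<noteq> []" by simp
  ultimately show ?thesis by (simp only: trace_tensor_eq src len not_False_eq_True)
qed

lemma trace_entries_regular:
  assumes \<rho>: "\<forall>B\<in>Br X act W. is_realization X act (bmod B) (bgrad B) (\<rho> B)"
    and us: "us \<in> hochschild_tensors X act W k"
    and i: "i \<in> (\<Pi>\<^sub>E s\<in>{..length us - 1}. {..<rrank (\<rho> (asrc (us ! s)))})"
  shows "trace_entries X \<rho> us i \<in> {fs. length fs = Suc k \<and> set fs \<subseteq> regular X}"
proof -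
  have len: "length us = Suc k" using us by (simp add: hochschild_tensors_def)
  have "matrix_entry X (\<rho> (asrc (us ! s))) (\<rho> (atgt (us ! s)))
     (amap (us ! s)) (i s) (i (Suc s mod length us)) \<in> regular X" if "s \<le> k" for s
  proof (rule matrix_entry_regular)
    have "Suc s mod Suc k \<le> k"
      using mod_less_divisor[of "Suc k" "Suc s"] by linarith
    then have "asrc (us ! s) \<in> Br X act W" "atgt (us ! s) \<in> Br X act W"
      using us that by (auto simp: hochschild_tensors_def)
    then show "is_realization X act (bmod (asrc (us ! s))) (bgrad (asrc (us ! s))) (\<rho> (asrc (us ! s)))"
      "is_realization X act (bmod (atgt (us ! s))) (bgrad (atgt (us ! s))) (\<rho> (atgt (us ! s)))"
      using \<rho> by auto
    show "amap (us ! s) \<in> graded_hom (coord_ring X) (bmod (asrc (us ! s))) (bgrad (asrc (us ! s)))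
        (bmod (atgt (us ! s))) (bgrad (atgt (us ! s))) (adeg (us ! s))"
      using us that unfolding hochschild_tensors_def brane_hom_def by blast
    show "i s < rrank (\<rho> (asrc (us ! s)))"
      using i that len by (auto simp: PiE_def Pi_def)
  qed
  then show ?thesis using len by (auto simp: trace_entries_def simp del: upt_Suc)
qed

text \<open>For each index tuple the entry in the varied slot is linear in the map, so a Hochschild
  relation goes to a signed sum of relations between tensors of functions.\<close>

lemma gen_trace_single:
  fixes us :: "('N::finite pt \<Rightarrow> complex, 'm) arrow list"
  assumes \<rho>: "\<forall>B\<in>Br X act W. is_realization X act (bmod B) (bgrad B) (\<rho> B)"
    and \<psi>: "\<psi> k = hochschild_class X act W k (Poly_Mapping.single us 1)"
  shows "gen_trace X \<rho> \<psi> k = ring_tensor_class X k (trace_tensor X \<rho> us)"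
proof -
  let ?B = "{fs. length fs = Suc k \<and> set fs \<subseteq> regular X}"
  let ?R = "multilinear_relations ?B
    (\<lambda>f g h. h = (\<lambda>x. f x + g x)) (\<lambda>c f h. h = (\<lambda>x. c * f x))"
  let ?H = "hochschild_tensors X act W k :: ('N pt \<Rightarrow> complex, 'm) arrow list set"
  let ?I = "\<lambda>us. \<Pi>\<^sub>E s\<in>{..length us - 1}. {..<rrank (\<rho> (asrc (us ! s)))}"
  \<comment> \<open>The target of the arrow lies in \<open>Br\<close> because it is the source of
    the cyclically next arrow.\<close>
  have loc: "is_realization X act (bmod (asrc u)) (bgrad (asrc u)) (\<rho> (asrc u))
" "is_realization X act (bmod (atgt u)) (bgrad (atgt u)) (\<rho> (atgt u))"
      "amap u \<in> graded_hom (coord_ring X) (bmod (asrc u)) (bgrad (asrc u))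
        (bmod (atgt u)) (bgrad (atgt u)) (adeg u)"
    if "xs @ u # ys \<in> ?H" for xs u ys
  proof -
    have len: "length (xs @ u # ys) = Suc k" using that by (simp add: hochschild_tensors_def)
    have *: "asrc ((xs @ u # ys) ! s) \<in> Br X act W"
      "atgt ((xs @ u # ys) ! s) = asrc ((xs @ u # ys) ! (Suc s mod Suc k))"
      "amap ((xs @ u # ys) ! s) \<in> brane_hom X (asrc ((xs @ u # ys) ! s))
        (atgt ((xs @ u # ys) ! s)) (adeg ((xs @ u # ys) ! s))" if "s \<le> k" for s
      using \<open>xs @ u # ys \<in> ?H\<close> that unfolding hochschild_tensors_def by blast+
    have l: "length xs \<le> k" using len by simp
    have m: "Suc (length xs) mod Suc k \<le> k"
      using mod_less_divisor[of "Suc k" "Suc (length xs)"] by linarith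
    have "asrc u \<in> Br X act W" "atgt u \<in> Br X act W"
      "amap u \<in> brane_hom X (asrc u) (atgt u) (adeg u)"
      using *[OF l] *(1)[OF m] by simp_all
    then show "is_realization X act (bmod (asrc u)) (bgrad (asrc u)) (\<rho> (asrc u))"
      "is_realization X act (bmod (atgt u)) (bgrad (atgt u)) (\<rho> (atgt u))"
      "amap u \<in> graded_hom (coord_ring X) (bmod (asrc u)) (bgrad (asrc u))
        (bmod (atgt u)) (bgrad (atgt u)) (adeg u)"
      using \<rho> by (auto simp: brane_hom_def)
  qed
  have bound: "i (length xs) < rrank (\<rho> (asrc u))" if "i \<in> ?I (xs @ u # ys)" for i xs u ys
    using PiE_mem[OF that, of "length xs"] by simp
  have adds: "trace_tensor X \<rho> (xs @ w # ys) - trace_tensor X \<rho> (xs @ u # ys)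
      - trace_tensor X \<rho> (xs @ v # ys) \<in> ?R"
    if uvw: "arrow_add u v w" and B: "xs @ u # ys \<in> ?H" "xs @ v # ys \<in> ?H" "xs @ w # ys \<in> ?H"
    for xs u v w ys
  proof -
    let ?L = "\<lambda>u. trace_entries X \<rho> (xs @ u # ys)"
    have eq: "asrc v = asrc u" "atgt v = atgt u" "adeg v = adeg u"
      "asrc w = asrc u" "atgt w = atgt u" "adeg w = adeg u"
      and w: "amap w = restrict (\<lambda>m. amap u m \<oplus>\<^bsub>bmod (atgt u)\<^esub> amap v m) (carrier (bmod (asrc u)))"
      using uvw by (auto simp: arrow_add_def)
    have I: "?I (xs @ v # ys) = ?I (xs @ u # ys)" "?I (xs @ w # ys) = ?I (xs @ u # ys)"
      using nth_append_Cons_cong[of asrc v u xs ys] nth_append_Cons_cong[of asrc w u xs ys] eq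
      by simp_all
    have "Poly_Mapping.single (?L w i) 1 - Poly_Mapping.single (?L u i) 1
        - Poly_Mapping.single (?L v i) 1 \<in> ?R" if i: "i \<in> ?I (xs @ u # ys)" for i
    proof -
      have mem: "?L u i \<in> ?B" "?L v i \<in> ?B" "?L w i \<in> ?B"
        by (rule trace_entries_regular[OF \<rho> B(1) i]
            trace_entries_regular[OF \<rho> B(2), unfolded I, OF i]
            trace_entries_regular[OF \<rho> B(3), unfolded I, OF i])+
      let ?e = "\<lambda>f. matrix_entry X (\<rho> (asrc u)) (\<rho> (atgt u)) f (i (length xs))
        (i (Suc (length xs) mod length (xs @ u # ys)))"
      have "?e (amap w) = (\<lambda>x. ?e (amap u) x + ?e (amap v) x)"
        unfolding w using loc[OF B(2)] unfolding eq
        by (intro matrix_entry_add[OF loc[OF B(1)] _ bound[OF i]])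
      \<comment> \<open>The instance with \<open>refl\<close> splits the list of \<open>u\<close>
        itself into prefix, entry and suffix, so all three lists share \<open>P\<close> and
        \<open>Q\<close>.\<close>
      moreover obtain P Q where L: "?L u i = P @ ?e (amap u) # Q"
        "?L v i = P @ ?e (amap v) # Q" "?L w i = P @ ?e (amap w) # Q"
        using trace_entries_replace[OF refl refl, of X \<rho> xs u ys i]
          trace_entries_replace[OF eq(1,2), of X \<rho> xs ys i]
          trace_entries_replace[OF eq(4,5), of X \<rho> xs ys i] by blast
      ultimately show ?thesis
        using mem unfolding L by (intro multilinear_relations_add)
    qed
    \<comment> \<open>Each relation is multiplied by the sign common to the three traces, and the
      results are summed.\<close>
    then have "cscale ((-1) powi trace_exponent \<rho> (xs @ u # ys) i)
      (Poly_Mapping.single (?L w i) 1 - Poly_Mapping.single (?L u i) 1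
        - Poly_Mapping.single (?L v i) 1) \<in> ?R" if "i \<in> ?I (xs @ u # ys)" for i
      using that by (intro cfree.subspace_scale[OF subspace_multilinear_relations])
    then have "(\<Sum>i\<in>?I (xs @ u # ys). cscale ((-1) powi trace_exponent \<rho> (xs @ u # ys) i)
      (Poly_Mapping.single (?L w i) 1 - Poly_Mapping.single (?L u i) 1
        - Poly_Mapping.single (?L v i) 1)) \<in> ?R"
      by (intro cfree.subspace_sum[OF subspace_multilinear_relations])
    then show ?thesis
      unfolding trace_tensor_replace[OF eq(4,6)] trace_tensor_replace[OF eq(1,3)]
        trace_tensor_replace[OF refl refl, of X \<rho> xs u ys]
      by (simp only: cfree.scale_right_diff_distrib cscale_single mult_1_right sum_subtractf)
  qed
  have scales: "trace_tensor X \<rho> (xs @ w # ys) - cscale c (trace_tensor X \<rho> (xs @ u # ys)) \<in> ?R"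
    if uw: "arrow_scale X c u w" and B: "xs @ u # ys \<in> ?H" "xs @ w # ys \<in> ?H" for c xs u w ys
  proof -
    let ?L = "\<lambda>u. trace_entries X \<rho> (xs @ u # ys)"
    have eq: "asrc w = asrc u" "atgt w = atgt u" "adeg w = adeg u"
      and w: "amap w = restrict (\<lambda>m. const_fun X c \<odot>\<^bsub>bmod (atgt u)\<^esub> amap u m) (carrier (bmod (asrc u)))"
      using uw by (auto simp: arrow_scale_def)
    have I: "?I (xs @ w # ys) = ?I (xs @ u # ys)"
      using nth_append_Cons_cong[of asrc w u xs ys] eq by simp
    have "Poly_Mapping.single (?L w i) 1 - Poly_Mapping.single (?L u i) c \<in> ?R"
      if i: "i \<in> ?I (xs @ u # ys)" for i
    proof -
      have mem: "?L u i \<in> ?B" "?L w i \<in> ?B"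
        by (rule trace_entries_regular[OF \<rho> B(1) i]
            trace_entries_regular[OF \<rho> B(2), unfolded I, OF i])+
      let ?e = "\<lambda>f. matrix_entry X (\<rho> (asrc u)) (\<rho> (atgt u)) f (i (length xs))
        (i (Suc (length xs) mod length (xs @ u # ys)))"
      have "?e (amap w) = (\<lambda>x. c * ?e (amap u) x)"
        unfolding w by (rule matrix_entry_scale[OF loc[OF B(1)] bound[OF i]])
      moreover obtain P Q where L: "?L u i = P @ ?e (amap u) # Q" "?L w i = P @ ?e (amap w) # Q"
        using trace_entries_replace[OF refl refl, of X \<rho> xs u ys i]
          trace_entries_replace[OF eq(1,2), of X \<rho> xs ys i] by blast
      ultimately show ?thesis
        using mem unfolding L by (intro multilinear_relations_scale)
    qed
    then have "cscale ((-1) powi trace_exponent \<rho> (xs @ u # ys) i)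
      (Poly_Mapping.single (?L w i) 1 - Poly_Mapping.single (?L u i) c) \<in> ?R"
      if "i \<in> ?I (xs @ u # ys)" for i
      using that by (intro cfree.subspace_scale[OF subspace_multilinear_relations])
    then have "(\<Sum>i\<in>?I (xs @ u # ys). cscale ((-1) powi trace_exponent \<rho> (xs @ u # ys) i)
      (Poly_Mapping.single (?L w i) 1 - Poly_Mapping.single (?L u i) c)) \<in> ?R"
      by (intro cfree.subspace_sum[OF subspace_multilinear_relations])
    then show ?thesis
      unfolding trace_tensor_replace[OF eq(1,3)] trace_tensor_replace[OF refl refl, of X \<rho> xs u ys]
      by (simp only: cfree.scale_right_diff_distrib cscale_single mult_1_right sum_subtractf
          cfree.scale_sum_right mult.commute[of c])
  qed
  have "gen_trace X \<rho> \<psi> k = ring_tensor_class X k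
      (lin_ext (trace_tensor X \<rho>) (Poly_Mapping.single us 1))"
    unfolding gen_trace_def \<psi> hochschild_class_def ring_tensor_class_def
    by (rule the_elem_lin_ext_tensor_class) (fact adds, fact scales)
  then show ?thesis by (simp add: lin_ext_single)
qed

section \<open>Signs\<close>

lemma minus_one_powi_cong:
  assumes "even (k - l)"
  shows "(-1 :: complex) powi k = (-1) powi l"
proof (cases "even k")
  case True
  then have "even l" using assms by presburger
  then show ?thesis using True by simp
next
  case False
  then have "odd l" using assms by presburger
  then show ?thesis using False by simp
qed

text \<open>The parity of \<sigma> flips at each of the n steps of the path from \<open>js\<close>
  to \<open>j\<close>. A node at distance d from the end thus has the parity of
  \<open>\<sigma> j + d\<close>; summing over d = 1, ..., n gives n(n+1)/2, which is congruent to
  \<open>(n + 1) div 2\<close> modulo 2.\<close>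

lemma alternating_parity:
  fixes \<sigma> :: "nat \<Rightarrow> int"
  assumes "\<forall>(k, l)\<in>set (zip js (tl (js @ [j]))). even (1 + \<sigma> l - \<sigma> k)"
  shows "even (\<sigma> (hd (js @ [j])) + \<sigma> j + int (length js))"
    and "even ((\<Sum>k\<leftarrow>js. \<sigma> k) + int (length js) * \<sigma> j + int ((length js + 1) div 2))"
proof -
  have "even (\<sigma> (hd (js @ [j])) + \<sigma> j + int (length js)) \<and>
    even ((\<Sum>k\<leftarrow>js. \<sigma> k) + int (length js) * \<sigma> j + int ((length js + 1) div 2))"
    using assms
  proof (induction js)
    case Nil
    then show ?case by simp
  next
    case (Cons k js)
    have zip: "zip (k # js) (tl ((k # js) @ [j])) = (k, hd (js @ [j])) # zip js (tl (js @ [j]))"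
      by (cases js) auto
    have tail: "\<forall>(k, l)\<in>set (zip js (tl (js @ [j]))). even (1 + \<sigma> l - \<sigma> k)"
      and head: "even (1 + \<sigma> (hd (js @ [j])) - \<sigma> k)"
      using Cons.prems unfolding zip by (simp_all del: even_diff even_add)
    let ?L = "length js"
    \<comment> \<open>The term \<open>m\<close> is a product of two variables; opaque names leave
      linear parity facts for \<open>presburger\<close>.\<close>
    define S m q q' where "S = (\<Sum>k\<leftarrow>js. \<sigma> k)" and "m = int ?L * \<sigma> j"
      and "q = int ((?L + 1) div 2)" and "q' = int ((length (k # js) + 1) div 2)"
    \<comment> \<open>The halves of L and L + 1, both rounded up, add to L + 1; this controls the
      last summand when the path gains a node.\<close>
    have "even ((?L + 1) div 2 + (?L + 1 + 1) div 2 + ?L + 1)" by presburger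
    then have "even (int ((?L + 1) div 2 + (?L + 1 + 1) div 2 + ?L + 1))"
      by (simp only: even_of_nat)
    then have "even (q + q' + int ?L + 1)"
      by (simp add: q_def q'_def)
    moreover have "even (\<sigma> (hd (js @ [j])) + \<sigma> j + int ?L)" "even (S + m + q)"
      using Cons.IH[OF tail] by (simp_all only: S_def m_def q_def)
    ultimately have "even (\<sigma> k + \<sigma> j + (int ?L + 1))" "even (\<sigma> k + S + (m + \<sigma> j) + q')"
      using head by presburger+
    moreover have "int (length (k # js)) = int ?L + 1"
      "int (length (k # js)) * \<sigma> j = m + \<sigma> j" "(\<Sum>k\<leftarrow>k # js. \<sigma> k) = \<sigma> k + S"
      "hd ((k # js) @ [j]) = k"
      by (simp_all add: m_def S_def algebra_simps)
    ultimately show ?case by (simp only: q'_def)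
  qed
  then show "even (\<sigma> (hd (js @ [j])) + \<sigma> j + int (length js))"
    and "even ((\<Sum>k\<leftarrow>js. \<sigma> k) + int (length js) * \<sigma> j + int ((length js + 1) div 2))"
    by blast+
qed

section \<open>Powers of matrices of forms\<close>

lemma lists_length_Suc_sum:
  assumes "finite R"
  shows "(\<Sum>is\<in>{is. set is \<subseteq> R \<and> length is = Suc n}. F is) =
    (\<Sum>k\<in>R. \<Sum>js\<in>{js. set js \<subseteq> R \<and> length js = n}. F (k # js))"
proof -
  have "(\<Sum>is\<in>{is. set is \<subseteq> R \<and> length is = Suc n}. F is) =
      (\<Sum>(k, js)\<in>R \<times> {js. set js \<subseteq> R \<and> length js = n}. F (k # js))"
    by (rule sum.reindex_bij_witness[where i = "\<lambda>(k, js). k # js" and j = "\<lambda>is. (hd is, tl is)"])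
       (auto simp: length_Suc_conv)
  then show ?thesis by (simp add: sum.cartesian_product)
qed

text \<open>The trace sums over index functions, the matrix power over index lists. Tabulation is a
  bijection because functions in \<open>PiE\<close> are fixed outside their domain.\<close>

lemma PiE_lists_length_sum:
  fixes F :: "'a list \<Rightarrow> 'b::comm_monoid_add"
  shows "(\<Sum>i\<in>(\<Pi>\<^sub>E s\<in>{..n}. R). F (map i [0..<Suc n])) =
    (\<Sum>is\<in>{is. set is \<subseteq> R \<and> length is = Suc n}. F is)"
proof (rule sum.reindex_bij_witness[where j = "\<lambda>i. map i [0..<Suc n]"
      and i = "\<lambda>is. restrict (\<lambda>s. is ! s) {..n}"])
  fix i assume i: "i \<in> (\<Pi>\<^sub>E s\<in>{..n}. R)"
  show "restrict (\<lambda>s. map i [0..<Suc n] ! s) {..n} = i"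
  proof
    fix s
    show "restrict (\<lambda>s. map i [0..<Suc n] ! s) {..n} s = i s"
      using PiE_arb[OF i, of s] by (cases "s \<le> n") (simp_all del: upt_Suc)
  qed
  show "map i [0..<Suc n] \<in> {is. set is \<subseteq> R \<and> length is = Suc n}"
    using i by (auto simp: PiE_def Pi_def simp del: upt_Suc)
next
  fix js :: "'a list"
  assume "js \<in> {is. set is \<subseteq> R \<and> length is = Suc n}"
  then have js: "set js \<subseteq> R" "length js = Suc n" by auto
  show "map (restrict (\<lambda>s. js ! s) {..n}) [0..<Suc n] = js"
    using js by (intro nth_equalityI) (auto simp del: upt_Suc)
  show "restrict (\<lambda>s. js ! s) {..n} \<in> (\<Pi>\<^sub>E s\<in>{..n}. R)"
    using js by (auto intro!: subsetD[OF js(1)])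
qed simp

text \<open>This is one row of a matrix product in which \<open>P k\<close> collects the paths
  starting at \<open>k\<close>; after exchanging the sums each path is met once, at its own
  start.\<close>

lemma sum_wedge_row:
  fixes A :: "nat \<Rightarrow> 'N::finite form"
  assumes P: "\<And>k. k < r \<Longrightarrow> P k = (\<lambda>p vs. \<Sum>js\<in>J. if h js = k then F js p vs else 0)"
    and h: "\<And>js. js \<in> J \<Longrightarrow> h js < r"
  shows "(\<Sum>k<r. wedge (A k) (P k) p vs) = (\<Sum>js\<in>J. wedge (A (h js)) (F js) p vs)"
proof -
  have if_wedge: "wedge \<omega> (\<lambda>p vs. if b then \<eta> p vs else 0) p vs = (if b then wedge \<omega> \<eta> p vs else 0)"
    for \<omega> \<eta> :: "'N form" and b
    by (simp add: wedge_0_right)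
  have "(\<Sum>k<r. wedge (A k) (P k) p vs) =
      (\<Sum>k<r. \<Sum>js\<in>J. if h js = k then wedge (A k) (F js) p vs else 0)"
    by (simp add: P wedge_sum_right if_wedge)
  also have "\<dots> = (\<Sum>js\<in>J. \<Sum>k<r. if h js = k then wedge (A k) (F js) p vs else 0)"
    by (rule sum.swap)
  also have "\<dots> = (\<Sum>js\<in>J. wedge (A (h js)) (F js) p vs)"
    by (rule sum.cong) (simp_all add: sum.delta' h)
  finally show ?thesis .
qed

lemma hd_append_single_less:
  assumes "js \<in> {js. set js \<subseteq> {..<r} \<and> length js = n}" "j < r"
  shows "hd (js @ [j]) < r"
  using assms by (cases js) auto

text \<open>A list \<open>js = [k\<^sub>1, \<dots>, k\<^sub>n]\<close> encodes the path from \<open>k\<^sub>1\<close> through \<open>k\<^sub>n\<close> to \<open>j\<close>; for \<open>n = 0\<close> the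
  path is constant at \<open>j\<close>, which is why its start is \<open>hd (js @ [j])\<close>.\<close>

lemma form_mat_pow_eq_sum_paths:
  assumes "j < r" "k < r"
  shows "form_mat_pow X r A n k j = (\<lambda>p vs.
    \<Sum>js\<in>{js. set js \<subseteq> {..<r} \<and> length js = n}. if hd (js @ [j]) = k
      then foldr wedge (map2 A js (tl (js @ [j]))) (fun_form (const_fun X 1)) p vs else 0)"
  using \<open>k < r\<close>
proof (induction n arbitrary: k)
  case 0
  \<comment> \<open>The empty path is the only one and starts at \<open>j\<close>, so the sum is the
    identity matrix.\<close>
  have "{js. set js \<subseteq> {..<r} \<and> js = []} = {[]}" by auto
  then show ?case
    by (auto simp: form_mat_pow_def form_mat_one_def fun_eq_iff)
next
  case (Suc n)
  let ?J = "{js. set js \<subseteq> {..<r} \<and> length js = n}"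
  let ?F = "\<lambda>js. foldr wedge (map2 A js (tl (js @ [j]))) (fun_form (const_fun X 1))"
  have map2: "map2 A (l # js) (tl ((l # js) @ [j])) =
      A l (hd (js @ [j])) # map2 A js (tl (js @ [j]))" for l js
    by (cases js) auto
  have "form_mat_pow X r A (Suc n) k j p vs = (\<Sum>js\<in>?J. wedge (A k (hd (js @ [j]))) (?F js) p vs)"
    for p vs
  proof -
    have "form_mat_pow X r A (Suc n) k j p vs =
        (\<Sum>l<r. wedge (A k l) (form_mat_pow X r A n l j) p vs)"
      by (simp add: form_mat_pow_def form_mat_mult_def)
    also have "\<dots> = (\<Sum>js\<in>?J. wedge (A k (hd (js @ [j]))) (?F js) p vs)"
      by (rule sum_wedge_row[OF Suc.IH hd_append_single_less[OF _ \<open>j < r\<close>]])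
    finally show ?thesis .
  qed
  \<comment> \<open>The condition forces the first node to be \<open>k\<close>; splitting it off
    leaves paths of length \<open>n\<close> with free start.\<close>
  moreover have "(\<Sum>js\<in>{js. set js \<subseteq> {..<r} \<and> length js = Suc n}.
      if hd (js @ [j]) = k then ?F js p vs else 0) =
    (\<Sum>js\<in>?J. wedge (A k (hd (js @ [j]))) (?F js) p vs)" for p vs
  proof -
    have "(\<Sum>js\<in>{js. set js \<subseteq> {..<r} \<and> length js = Suc n}.
        if hd (js @ [j]) = k then ?F js p vs else 0) =
      (\<Sum>l<r. \<Sum>js\<in>?J. if l = k then ?F (l # js) p vs else 0)"
      by (subst lists_length_Suc_sum) auto
    also have "\<dots> = (\<Sum>l<r. if l = k then \<Sum>js\<in>?J. ?F (l # js) p vs else 0)"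
      by (intro sum.cong) auto
    also have "\<dots> = (\<Sum>js\<in>?J. ?F (k # js) p vs)"
      using \<open>k < r\<close> by (simp add: sum.delta)
    also have "\<dots> = (\<Sum>js\<in>?J. wedge (A k (hd (js @ [j]))) (?F js) p vs)"
      unfolding map2 by simp
    finally show ?thesis .
  qed
  ultimately show ?case by (simp add: fun_eq_iff)
qed

section \<open>Linearity of the residue\<close>

text \<open>\<open>cube_integral\<close> evaluates forms on exactly \<open>n\<close> vectors, so
  proportionality on such lists makes the integrals proportional, while the admissible cubes depend
  on \<open>F\<close> only.\<close>

lemma has_local_residue_cmult:
  assumes "has_local_residue n X F p \<eta> r"
    and "\<And>q vs. length vs = n \<Longrightarrow> \<omega> q vs = c * \<eta> q vs"
  shows "has_local_residue n X F p \<omega> (c * r)"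
proof -
  \<comment> \<open>The scalar leaves the integral even without integrability, as the integral of a
    non-integrable function is 0.\<close>
  have "cube_integral n F \<omega> \<gamma> = c * cube_integral n F \<eta> \<gamma>" for \<gamma>
    unfolding cube_integral_def set_lebesgue_integral_def
    by (subst integral_mult_right_zero[symmetric]) (simp add: assms(2) algebra_simps)
  then have "1 / (2 * of_real pi * \<i>) ^ n * (\<Sum>\<gamma>\<leftarrow>Q. cube_integral n F \<omega> \<gamma>) =
      c * (1 / (2 * of_real pi * \<i>) ^ n * (\<Sum>\<gamma>\<leftarrow>Q. cube_integral n F \<eta> \<gamma>))" for Q
    by (simp add: sum_list_const_mult)
  moreover note assms(1)[unfolded has_local_residue_def]
  ultimately show ?thesis
    unfolding has_local_residue_def by (elim eventually_mono) (auto elim!: eventually_mono)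
qed

text \<open>Cube decompositions exist for arbitrarily small radii while both value conditions hold
  for all small ones, so a common decomposition fixes the value.\<close>

lemma has_local_residue_unique:
  assumes "has_local_residue n X F p \<omega> c" "has_local_residue n X F p \<omega> c'"
  shows "c = c'"
proof -
  have "\<forall>\<^sub>F \<delta> in at_right (0 :: real). c = c'"
    using assms(1)[unfolded has_local_residue_def] assms(2)[unfolded has_local_residue_def]
  proof eventually_elim
    case (elim \<delta>)
    from frequently_eventually_frequently[OF frequently_eventually_frequently[OF
        conjunct1[OF elim(1)] conjunct2[OF elim(1)]] conjunct2[OF elim(2)]]
    show ?case by (auto dest: frequently_ex)
  qed
  then show ?thesis by simp
qed

text \<open>Without a residue value \<open>local_residue\<close> defaults to 0. As \<open>c\<close>
  is invertible, \<omega> has a value iff \<eta> has, so the default respects scaling too.\<close>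

lemma local_residue_cmult:
  assumes "c \<noteq> 0" "\<And>q vs. length vs = n \<Longrightarrow> \<omega> q vs = c * \<eta> q vs"
  shows "local_residue n X F p \<omega> = c * local_residue n X F p \<eta>"
proof (cases "\<exists>r. has_local_residue n X F p \<eta> r")
  case True
  then obtain r where r: "has_local_residue n X F p \<eta> r" by blast
  have "local_residue n X F p \<xi> = s" if "has_local_residue n X F p \<xi> s" for \<xi> s
  proof -
    have "(THE c. has_local_residue n X F p \<xi> c) = s"
      by (rule the_equality[of "has_local_residue n X F p \<xi>", OF that])
        (rule has_local_residue_unique[OF _ that])
    then show ?thesis using that unfolding local_residue_def by auto
  qed
  then show ?thesis using r has_local_residue_cmult[OF r assms(2)] by blast
next
  case False
  have "\<not> has_local_residue n X F p \<omega> r" for r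
    using has_local_residue_cmult[of n X F p \<omega> r \<eta> "inverse c"] assms False by (auto simp: field_simps)
  then show ?thesis using False by (simp add: local_residue_def)
qed

lemma Res_cmult:
  assumes "c \<noteq> 0" "\<And>q vs. length vs = n \<Longrightarrow> \<omega> q vs = c * \<eta> q vs"
  shows "Res n X W x \<omega> = c * Res n X W x \<eta>"
  unfolding Res_def sum_distrib_left by (intro sum.cong local_residue_cmult[OF assms]) auto

section \<open>The functional on endomorphisms\<close>

text \<open>The degrees of \<alpha> and of the \<open>n\<close> copies of the differential add up to
  \<open>a + n\<close>, and the trace adds \<open>n + 1\<close>; this is the factor
  \<open>a + 2 * int n + 1\<close>.\<close>

lemma phi_gen_trace_endo_chain:
  assumes \<rho>: "\<forall>B\<in>Br X act W. is_realization X act (bmod B) (bgrad B) (\<rho> B)"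
    and M: "M \<in> Br X act W" and \<alpha>: "\<alpha> \<in> brane_hom X M M a" and n: "length vs = n"
  defines "r \<equiv> rrank (\<rho> M)" and "\<sigma> \<equiv> rshift (\<rho> M)"
    and "A \<equiv> matrix_entry X (\<rho> M) (\<rho> M) \<alpha>" and "D \<equiv> matrix_entry X (\<rho> M) (\<rho> M) (bdiff M)"
  shows "phi X (gen_trace X \<rho> (T_d X act W (endo_chain X act W M a \<alpha>))) p vs =
    (\<Sum>i<r. \<Sum>js\<in>{js. set js \<subseteq> {..<r} \<and> length js = n}.
      (-1) powi ((a + 2 * int n + 1) * \<sigma> i + (\<Sum>k\<leftarrow>js. \<sigma> k)) *
      phi_tensor X (A i (hd (js @ [i])) # map2 D js (tl (js @ [i]))) p vs)"
proof -
  let ?u = "\<lparr>asrc = M, atgt = M, adeg = a, amap = \<alpha>\<rparr>"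
  let ?us = "?u # replicate n (brane_diff_arrow M)"
  let ?E = "\<lambda>s. if s = 0 then A else D"
  \<comment> \<open>Entries and exponent become functions of the index list, the form needed for
    \<open>PiE_lists_length_sum\<close>.\<close>
  let ?L = "\<lambda>is. map (\<lambda>s. ?E s (is ! s) (is ! (Suc s mod Suc n))) [0..<Suc n]"
  let ?e = "\<lambda>is. (a + 2 * int n + 1) * \<sigma> (is ! 0) + (\<Sum>s=1..n. \<sigma> (is ! s))"
  have nth: "?us ! s = (if s = 0 then ?u else brane_diff_arrow M)" if "s \<le> n" for s
    using that by (cases s) auto
  have mod: "Suc s mod Suc n \<le> n" for s
    using mod_less_divisor[of "Suc n" "Suc s"] by linarith
  have src: "asrc (?us ! s) = M" and tgt: "atgt (?us ! s) = M" if "s \<le> n" for s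
    using that by (simp_all add: nth brane_diff_arrow_simps)
  have entries: "trace_entries X \<rho> ?us i = ?L (map i [0..<Suc n])" for i
    unfolding trace_entries_def
    by (rule nth_equalityI)
       (auto simp: nth mod less_Suc_eq_le A_def D_def brane_diff_arrow_simps simp del: upt_Suc)
  have "(\<Sum>s\<le>n. adeg (?us ! s)) = (\<Sum>s\<le>n. if s = 0 then a else 1)"
    by (intro sum.cong) (auto simp: nth brane_diff_arrow_simps)
  also have "\<dots> = a + int n"
    by (subst sum.atMost_shift) simp
  finally have deg: "(\<Sum>s\<le>n. adeg (?us ! s)) = a + int n" .
  have exponent: "trace_exponent \<rho> ?us i = ?e (map i [0..<Suc n])" for i
  proof -
    have len: "length ?us - 1 = n" by simp
    have "(\<Sum>s=1..n. rshift (\<rho> (asrc (?us ! s))) (i s)) = (\<Sum>s=1..n. \<sigma> (map i [0..<Suc n] ! s))"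
      by (rule sum.cong, rule refl, subst src) (auto simp: \<sigma>_def simp del: upt_Suc)
    then show ?thesis
      unfolding trace_exponent_def Let_def len deg src[OF le0] \<sigma>_def[symmetric]
      by (simp del: upt_Suc)
  qed
  have I: "(\<Pi>\<^sub>E s\<in>{..length ?us - 1}. {..<rrank (\<rho> (asrc (?us ! s)))}) = (\<Pi>\<^sub>E s\<in>{..n}. {..<r})"
  proof -
    have "length ?us - 1 = n" by simp
    then show ?thesis
      by (simp only:) (rule PiE_cong, subst src, auto simp: r_def)
  qed
  \<comment> \<open>The successor of position \<open>n\<close> wraps around to \<open>i\<close>, so
    the column indices read \<open>js @ [i]\<close>.\<close>
  have cons: "?L (i # js) = A i (hd (js @ [i])) # map2 D js (tl (js @ [i]))"
    if "length js = n" for i js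
  proof (rule nth_equalityI)
    show "length (?L (i # js)) = length (A i (hd (js @ [i])) # map2 D js (tl (js @ [i])))"
      using that by simp
    fix s assume "s < length (?L (i # js))"
    then have s: "s \<le> n" by simp
    then have "(i # js) ! (Suc s mod Suc n) = (js @ [i]) ! s"
      using that by (cases "s = n") (auto simp: nth_append)
    then show "?L (i # js) ! s = (A i (hd (js @ [i])) # map2 D js (tl (js @ [i]))) ! s"
      using s that by (cases s) (simp_all add: hd_conv_nth nth_tl del: upt_Suc)
  qed
  have "phi X (gen_trace X \<rho> (T_d X act W (endo_chain X act W M a \<alpha>))) p vs =
      phi_deg X (gen_trace X \<rho> (T_d X act W (endo_chain X act W M a \<alpha>)) n) p vs"
    by (simp add: phi_def n)
  also have "\<dots> = lin_comb (*) (\<lambda>fs. phi_tensor X fs p vs) (trace_tensor X \<rho> ?us)"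
    unfolding gen_trace_single[OF \<rho> T_d_endo_chain[OF M \<alpha>]] phi_deg_ring_tensor_class ..
  also have "\<dots> = (\<Sum>i\<in>(\<Pi>\<^sub>E s\<in>{..n}. {..<r}). (-1) powi ?e (map i [0..<Suc n]) *
      phi_tensor X (?L (map i [0..<Suc n])) p vs)"
    by (simp only: trace_tensor_eq[OF list.distinct(2)] I entries exponent
        lin_comb_sum[OF vector_space_complex] lin_comb_single[OF vector_space_complex])
  also have "\<dots> = (\<Sum>is\<in>{is. set is \<subseteq> {..<r} \<and> length is = Suc n}.
      (-1) powi ?e is * phi_tensor X (?L is) p vs)"
    by (rule PiE_lists_length_sum)
  also have "\<dots> = (\<Sum>i<r. \<Sum>js\<in>{js. set js \<subseteq> {..<r} \<and> length js = n}.
      (-1) powi ?e (i # js) * phi_tensor X (?L (i # js)) p vs)"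
    by (rule lists_length_Suc_sum) simp
  also have "\<dots> = (\<Sum>i<r. \<Sum>js\<in>{js. set js \<subseteq> {..<r} \<and> length js = n}.
      (-1) powi ((a + 2 * int n + 1) * \<sigma> i + (\<Sum>k\<leftarrow>js. \<sigma> k)) *
      phi_tensor X (A i (hd (js @ [i])) # map2 D js (tl (js @ [i]))) p vs)"
  proof (intro sum.cong refl)
    fix i js assume "js \<in> {js. set js \<subseteq> {..<r} \<and> length js = n}"
    then have js: "length js = n" by simp
    have "(\<Sum>s=1..n. \<sigma> ((i # js) ! s)) = (\<Sum>k\<leftarrow>js. \<sigma> k)"
      by (simp add: sum.atLeast1_atMost_eq sum_list_sum_nth js atLeast0LessThan)
    then show "(-1) powi ?e (i # js) * phi_tensor X (?L (i # js)) p vs =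
      (-1) powi ((a + 2 * int n + 1) * \<sigma> i + (\<Sum>k\<leftarrow>js. \<sigma> k)) *
      phi_tensor X (A i (hd (js @ [i])) # map2 D js (tl (js @ [i]))) p vs"
      unfolding cons[OF js] by simp
  qed
  finally show ?thesis .
qed

text \<open>A diagonal entry sums over closed paths: one step by \<open>A\<close> from
  \<open>i\<close> to the start of the path, then \<open>n\<close> steps by \<open>D\<close> back to
  \<open>i\<close>. The factor \<open>fact n\<close> undoes the one divided out in
  \<open>phi_tensor\<close>.\<close>

lemma supertrace_form_mat_pow:
  "supertrace r \<sigma> (form_mat_mult r (\<lambda>i j. fun_form (A i j))
      (form_mat_pow X r (\<lambda>i j. d_form X (D i j)) n)) p vs =
    (\<Sum>i<r. \<Sum>js\<in>{js. set js \<subseteq> {..<r} \<and> length js = n}. (-1) powi \<sigma> i * fact n *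
      phi_tensor X (A i (hd (js @ [i])) # map2 D js (tl (js @ [i]))) p vs)"
  (is "_ = (\<Sum>i<r. \<Sum>js\<in>?J. ?t i js)")
proof -
  have "(\<Sum>k<r. wedge (fun_form (A i k)) (form_mat_pow X r (\<lambda>i j. d_form X (D i j)) n k i) p vs) =
      (\<Sum>js\<in>?J. fact n * phi_tensor X (A i (hd (js @ [i])) # map2 D js (tl (js @ [i]))) p vs)"
    if i: "i < r" for i
  proof -
    have "fact n * phi_tensor X (A i (hd (js @ [i])) # map2 D js (tl (js @ [i]))) p vs =
      wedge (fun_form (A i (hd (js @ [i])))) (foldr wedge
        (map2 (\<lambda>i j. d_form X (D i j)) js (tl (js @ [i]))) (fun_form (const_fun X 1))) p vs"
      if "length js = n" for js
      using that by (simp add: phi_tensor_Cons comp_def split_def)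
    then show ?thesis
      by (subst sum_wedge_row[OF form_mat_pow_eq_sum_paths[OF i] hd_append_single_less[OF _ i]]) auto
  qed
  then show ?thesis
    by (simp add: supertrace_def form_mat_mult_def mult.assoc flip: sum_distrib_left)
qed

theorem mainTheorem5:
  fixes n :: nat
    and X :: "(complex ^ 'N::finite) set"
    and act :: "complex \<Rightarrow> complex ^ 'N \<Rightarrow> complex ^ 'N"
    and W :: "complex ^ 'N \<Rightarrow> complex"
    and x :: "complex ^ 'N \<Rightarrow> nat \<Rightarrow> complex ^ 'N \<Rightarrow> complex"
    and \<rho> :: "(complex ^ 'N \<Rightarrow> complex, 'm) brane \<Rightarrow> (complex ^ 'N \<Rightarrow> complex, 'm) realization"
    and M :: "(complex ^ 'N \<Rightarrow> complex, 'm) brane"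
    and a :: int
    and \<alpha> :: "'m \<Rightarrow> 'm"
  assumes LG: "affine_LG_model n X act W"
    and isolated: "isolated_singularities X W"
    and coordinates: "\<forall>p\<in>critical_points X W. local_coordinates n X p (x p)"
    and realizations: "\<forall>B\<in>Br X act W. is_realization X act (bmod B) (bgrad B) (\<rho> B)"
    and brane: "M \<in> Br X act W"
    and homogeneous: "\<alpha> \<in> brane_hom X M M a"
  shows "(Res n X W x \<circ> phi X \<circ> gen_trace X \<rho> \<circ> T_d X act W) (endo_chain X act W M a \<alpha>) =
    (-1) ^ nat \<lceil>real n / 2\<rceil> / fact n *
    Res n X W x
      (supertrace (rrank (\<rho> M)) (rshift (\<rho> M))
        (form_mat_mult (rrank (\<rho> M))
          (\<lambda>i j. fun_form (matrix_entry X (\<rho> M) (\<rho> M) \<alpha> i j))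
          (form_mat_pow X (rrank (\<rho> M))
            (\<lambda>i j. d_form X (matrix_entry X (\<rho> M) (\<rho> M) (bdiff M) i j)) n)))"
proof -
  let ?r = "rrank (\<rho> M)" and ?\<sigma> = "rshift (\<rho> M)"
  let ?A = "matrix_entry X (\<rho> M) (\<rho> M) \<alpha>" and ?D = "matrix_entry X (\<rho> M) (\<rho> M) (bdiff M)"
  let ?c = "(-1) ^ nat \<lceil>real n / 2\<rceil> / fact n :: complex"
  let ?J = "{js. set js \<subseteq> {..<?r} \<and> length js = n}"
  let ?T = "\<lambda>i js. ?A i (hd (js @ [i])) # map2 ?D js (tl (js @ [i]))"
  have act: "algebraic_Cstar_action X act" and minus_one: "\<forall>x\<in>X. act (-1) x = x"
    using LG by (auto simp: affine_LG_model_def)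
  have real: "is_realization X act (bmod M) (bgrad M) (\<rho> M)"
    using realizations brane by blast
  have \<alpha>: "\<alpha> \<in> graded_hom (coord_ring X) (bmod M) (bgrad M) (bmod M) (bgrad M) a"
    and D: "bdiff M \<in> graded_hom (coord_ring X) (bmod M) (bgrad M) (bmod M) (bgrad M) 1"
    using homogeneous brane by (auto simp: brane_hom_def Br_def)
  have A0: "?A i j = (\<lambda>_. 0)" if "i < ?r" "j < ?r" "odd (a + ?\<sigma> j - ?\<sigma> i)" for i j
    using weight_space_odd[OF minus_one matrix_entry_weight_space[OF act real real \<alpha>]] that by blast
  have D0: "?D i j = (\<lambda>_. 0)" if "i < ?r" "j < ?r" "odd (1 + ?\<sigma> j - ?\<sigma> i)" for i j
    using weight_space_odd[OF minus_one matrix_entry_weight_space[OF act real real D]] that by blast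
  have "\<lceil>real n / 2\<rceil> = int ((n + 1) div 2)"
    by (rule ceiling_unique; cases "even n") (auto elim!: evenE oddE)
  then have ceil: "nat \<lceil>real n / 2\<rceil> = (n + 1) div 2" by simp
  have sign: "(-1) powi ((a + 2 * int n + 1) * ?\<sigma> i + (\<Sum>k\<leftarrow>js. ?\<sigma> k)) * phi_tensor X (?T i js) p vs =
      ?c * ((-1) powi ?\<sigma> i * fact n * phi_tensor X (?T i js) p vs)"
    if i: "i < ?r" and js: "js \<in> ?J" for i js p vs
  \<comment> \<open>A zero entry makes both sides vanish; signs need to agree only along paths of
    nonzero entries, where the parities are constrained.\<close>
  proof (cases "(\<lambda>_. 0) \<in> set (?T i js)")
    case True
    then show ?thesis by (simp add: phi_tensor_0)
  next
    case False
    have h: "hd (js @ [i]) < ?r" by (rule hd_append_single_less[OF js i])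
    have a_even: "even (a + ?\<sigma> (hd (js @ [i])) - ?\<sigma> i)"
      using A0[OF i h] False by auto
    have "even (1 + ?\<sigma> l - ?\<sigma> k)" if kl: "(k, l) \<in> set (zip js (tl (js @ [i])))" for k l
    proof -
      have "set (tl (js @ [i])) \<subseteq> insert i (set js)"
        by (cases js) auto
      then have "k < ?r" "l < ?r"
        using set_zip_leftD[OF kl] set_zip_rightD[OF kl] js i by auto
      moreover have "?D k l \<in> set (map2 ?D js (tl (js @ [i])))"
        using kl by force
      then have "?D k l \<noteq> (\<lambda>_. 0)"
        using False by (metis list.set_intros(2))
      ultimately show ?thesis using D0[of k l] by blast
    qed
    then have *: "\<forall>(k, l)\<in>set (zip js (tl (js @ [i]))). even (1 + ?\<sigma> l - ?\<sigma> k)" by blast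
    have len: "length js = n" using js by simp
    define m where "m = int n * ?\<sigma> i"
    have par: "even (?\<sigma> (hd (js @ [i])) + ?\<sigma> i + int n)"
      "even ((\<Sum>k\<leftarrow>js. ?\<sigma> k) + m + int ((n + 1) div 2))"
      using alternating_parity[OF *] unfolding len m_def by blast+
    \<comment> \<open>By \<open>a_even\<close> the degree \<open>a\<close> has the parity of the
      difference of the shifts at the two ends of the path, and by \<open>par\<close> so has
      \<open>n\<close>.\<close>
    have "even (a + int n)" using a_even par(1) by presburger
    then have "even ((a + int n) * ?\<sigma> i)" by simp
    \<comment> \<open>Removing \<open>m\<close> and the shift of \<open>i\<close> leaves
      \<open>(a + n)\<close> times that shift, up to an even multiple; \<open>par(2)\<close> then
      trades \<open>m\<close> and the sum over \<open>js\<close> for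
      \<open>(n + 1) div 2\<close>.\<close>
    then have "even ((a + 2 * int n + 1) * ?\<sigma> i - m - ?\<sigma> i)"
      by (simp add: m_def algebra_simps)
    then have "even ((a + 2 * int n + 1) * ?\<sigma> i + (\<Sum>k\<leftarrow>js. ?\<sigma> k)
        - (int ((n + 1) div 2) + ?\<sigma> i))"
      using par(2) by presburger
    then have "(-1) powi ((a + 2 * int n + 1) * ?\<sigma> i + (\<Sum>k\<leftarrow>js. ?\<sigma> k)) =
        (-1 :: complex) powi (int ((n + 1) div 2) + ?\<sigma> i)"
      by (rule minus_one_powi_cong)
    also have "\<dots> = (-1) ^ ((n + 1) div 2) * (-1) powi ?\<sigma> i"
      by (subst power_int_add) auto
    finally show ?thesis by (simp add: ceil)
  qed
  \<comment> \<open>Only lists of \<open>n\<close> vectors reach \<open>Res\<close>, so the two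
    forms are compared there alone.\<close>
  have "phi X (gen_trace X \<rho> (T_d X act W (endo_chain X act W M a \<alpha>))) p vs =
      ?c * supertrace ?r ?\<sigma> (form_mat_mult ?r (\<lambda>i j. fun_form (?A i j))
        (form_mat_pow X ?r (\<lambda>i j. d_form X (?D i j)) n)) p vs" if "length vs = n" for p vs
    unfolding phi_gen_trace_endo_chain[OF realizations brane homogeneous that]
      supertrace_form_mat_pow sum_distrib_left
    by (intro sum.cong refl sign) auto
  then show ?thesis
    unfolding comp_def by (intro Res_cmult) auto
qed

end
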